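(* Let $\mathfrak m=\mathfrak m(V,W,\beta)$ be an extended translation algebra over $\mathbb K=\mathbb R$ or $\mathbb C$ with $\dim V\ge3$, and let $\mathfrak g=\sum_p\mathfrak g_p$ be its maximal transitive prolongation. Then: 1. $\mathfrak m$ is of finite type, i.e. $\mathfrak g$ has finite dimension; 2. for all $p>0$ and $X\in\mathfrak g_p$, if $[X,\mathfrak g_{-2}]=0$ then $X=0$.
   Context: Let $\mathbb K=\mathbb R$ or $\mathbb C$ and let $V\neq0$ be a finite-dimensional $\mathbb K$-vector space with a nondegenerate (possibly indefinite in the real case) symmetric bilinear form $(\cdot,\cdot)$. The Clifford algebra $C\!\ell(V)$ has product satisfying $vu+uv=-2(v,u)\mathbf 1$ for $v,u\in V$. Let $W\ne0$ be a finite-dimensional $C\!\ell(V)$-module, with action written $c\cdot s$. The Lie algebra $\mathfrak{so}(V)$ acts on $V$ in the defining way and on $W$ by the spin representation, i.e. the endomorphism $w\mapsto (v,w)u-(u,w)v$ acts on $W$ as $\frac14(vu-uv)\in C\!\ell(V)$. Let $\beta$ be a nondegenerate bilinear form on $W$ such that: (B1) $\beta$ is $\mathfrak{so}(V)$-invariant; (B2) $\beta$ is symmetric (put $\epsilon=-1$) or skew-symmetric (put $\epsilon=1$); (B3) $\beta(v\cdot s,t)=\epsilon\beta(s,v\cdot t)$ for all $v\in V$, $s,t\in W$. The extended translation algebra $\mathfrak m=\mathfrak m(V,W,\beta)$ is the graded Lie algebra $\mathfrak m=\mathfrak m_{-2}+\mathfrak m_{-1}$, $\mathfrak m_{-2}=V$,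 $\mathfrak m_{-1}=W$, whose only nonzero bracket $W\times W\to V$ is given by $([s,t],v)=\beta(v\cdot s,t)$. The maximal transitive prolongation of $\mathfrak m$ is the (unique) graded Lie algebra $\mathfrak g=\sum_{p\in\mathbb Z}\mathfrak g_p$ such that (1) each $\mathfrak g_p$ is finite-dimensional; (2) the negatively graded part of $\mathfrak g$ is $\mathfrak m$ ($\mathfrak g_p=\mathfrak m_p$ for $p=-1,-2$ and $\mathfrak g_p=0$ for $p<-2$); (3) for all $p\ge0$, $X\in\mathfrak g_p$ with $[X,\mathfrak g_{-1}]=0$ implies $X=0$; (4) $\mathfrak g$ is maximal: any graded Lie algebra $\mathfrak g'$ satisfying (1)-(3) admits an injective graded Lie algebra homomorphism $\mathfrak g'\to\mathfrak g$. *)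

theory Defs
  imports
    Complex_Main
    "HOL-Library.Poly_Mapping"
    "HOL-Library.Product_Plus"
    "HOL-Library.Countable_Set"
    "HOL-Computational_Algebra.Polynomial"
    "HOL-Algebra.QuotRing"
begin

section \<open>Ground fields\<close>

text \<open>
  The ground field is the real or the complex field. The class makes this a single type variable.
  Only the field structure is used, so it is enough to say it up to field isomorphism.
\<close>

class real_or_complex = field +
  assumes real_or_complex:
    "(\<exists>f :: 'a \<Rightarrow> real. bij f \<and> (\<forall>x y. f (x + y) = f x + f y \<and> f (x * y) = f x * f y)) \<or>
     (\<exists>f :: 'a \<Rightarrow> complex. bij f \<and> (\<forall>x y. f (x + y) = f x + f y \<and> f (x * y) = f x * f y))"

instance real :: real_or_complex
  by standard (rule disjI1, rule exI[of _ "\<lambda>x. x"], simp add: bij_def)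

instance complex :: real_or_complex
  by standard (rule disjI2, rule exI[of _ "\<lambda>x. x"], simp add: bij_def)


section \<open>Vector spaces with bilinear forms\<close>

definition fin_dim :: "('k::field \<Rightarrow> 'a::ab_group_add \<Rightarrow> 'a) \<Rightarrow> 'a set \<Rightarrow> bool" where
  "fin_dim scale S \<longleftrightarrow> (\<exists>A. finite A \<and> S \<subseteq> module.span scale A)"

definition bilinear_form :: "('k::field \<Rightarrow> 'a::ab_group_add \<Rightarrow> 'a) \<Rightarrow> ('a \<Rightarrow> 'a \<Rightarrow> 'k) \<Rightarrow> bool" where
  "bilinear_form scale b \<longleftrightarrow>
     (\<forall>y. Vector_Spaces.linear scale (*) (\<lambda>x. b x y)) \<and>
     (\<forall>x. Vector_Spaces.linear scale (*) (\<lambda>y. b x y))"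

definition nondegenerate_form :: "('a::zero \<Rightarrow> 'a \<Rightarrow> 'k::zero) \<Rightarrow> bool" where
  "nondegenerate_form b \<longleftrightarrow>
     (\<forall>x. (\<forall>y. b x y = 0) \<longrightarrow> x = 0) \<and> (\<forall>y. (\<forall>x. b x y = 0) \<longrightarrow> y = 0)"

locale quadratic_space = vector_space scV
  for scV :: "'k::field \<Rightarrow> 'v::ab_group_add \<Rightarrow> 'v" +
  fixes B :: "'v \<Rightarrow> 'v \<Rightarrow> 'k"
  assumes V_nonzero: "\<exists>v::'v. v \<noteq> 0"
    and V_fin_dim: "fin_dim scV UNIV"
    and B_bilinear: "bilinear_form scV B"
    and B_sym: "B v u = B u v"
    and B_nondegenerate: "nondegenerate_form B"

text \<open>
  The orthogonal Lie algebra of \<open>V\<close>, as a set of endomorphisms, and its elements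
  \<open>w \<mapsto> (v,w)u - (u,w)v\<close>.
\<close>

definition so_algebra ::
    "('k::field \<Rightarrow> 'v::ab_group_add \<Rightarrow> 'v) \<Rightarrow> ('v \<Rightarrow> 'v \<Rightarrow> 'k) \<Rightarrow> ('v \<Rightarrow> 'v) set" where
  "so_algebra scV B =
     {A. Vector_Spaces.linear scV scV A \<and> (\<forall>x y. B (A x) y + B x (A y) = 0)}"

definition so_elem ::
    "('k::field \<Rightarrow> 'v::ab_group_add \<Rightarrow> 'v) \<Rightarrow> ('v \<Rightarrow> 'v \<Rightarrow> 'k) \<Rightarrow> 'v \<Rightarrow> 'v \<Rightarrow> 'v \<Rightarrow> 'v" where
  "so_elem scV B v u w = scV (B v w) u - scV (B u w) v"


section \<open>The Clifford algebra\<close>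

text \<open>
  The Clifford algebra is the free unital associative algebra on the set \<open>V\<close> modulo the two-sided
  ideal generated by the relations of linearity of \<open>V\<close> and \<open>vu + uv = -2(v,u)1\<close>.
  Elements of the free algebra are finitely supported functions on words, multiplied by convolution.
\<close>

datatype 'a free_word = Word (letters: "'a list")

instantiation free_word :: (type) monoid_add
begin
definition zero_free_word_def: "0 = Word []"
definition plus_free_word_def: "x + y = Word (letters x @ letters y)"
instance
  by standard (simp_all add: zero_free_word_def plus_free_word_def)
end

type_synonym ('v, 'k) free_algebra = "'v free_word \<Rightarrow>\<^sub>0 'k"

definition free_ring :: "('v, 'k::field) free_algebra ring" where
  "free_ring = \<lparr>carrier = UNIV, mult = (*), one = 1, zero = 0, add = (+)\<rparr>"

definition free_gen :: "'v \<Rightarrow> ('v, 'k::field) free_algebra" where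
  "free_gen v = Poly_Mapping.single (Word [v]) 1"

definition free_scalar :: "'k \<Rightarrow> ('v, 'k::field) free_algebra" where
  "free_scalar c = Poly_Mapping.single (Word []) c"

definition clifford_relators ::
    "('k::field \<Rightarrow> 'v::ab_group_add \<Rightarrow> 'v) \<Rightarrow> ('v \<Rightarrow> 'v \<Rightarrow> 'k) \<Rightarrow> ('v, 'k) free_algebra set" where
  "clifford_relators scV B =
     {free_gen (v + u) - (free_gen v + free_gen u) | v u. True} \<union>
     {free_gen (scV c v) - free_scalar c * free_gen v | c v. True} \<union>
     {free_gen v * free_gen u + free_gen u * free_gen v - free_scalar (- 2 * B v u) | v u. True}"

definition clifford_ideal ::
    "('k::field \<Rightarrow> 'v::ab_group_add \<Rightarrow> 'v) \<Rightarrow> ('v \<Rightarrow> 'v \<Rightarrow> 'k) \<Rightarrow> ('v, 'k) free_algebra set" where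
  "clifford_ideal scV B = genideal free_ring (clifford_relators scV B)"

definition clifford_algebra ::
    "('k::field \<Rightarrow> 'v::ab_group_add \<Rightarrow> 'v) \<Rightarrow> ('v \<Rightarrow> 'v \<Rightarrow> 'k) \<Rightarrow> ('v, 'k) free_algebra set ring" where
  "clifford_algebra scV B = free_ring Quot clifford_ideal scV B"

definition cl_vec ::
    "('k::field \<Rightarrow> 'v::ab_group_add \<Rightarrow> 'v) \<Rightarrow> ('v \<Rightarrow> 'v \<Rightarrow> 'k) \<Rightarrow> 'v \<Rightarrow> ('v, 'k) free_algebra set" where
  "cl_vec scV B v = clifford_ideal scV B +>\<^bsub>free_ring\<^esub> free_gen v"

definition cl_scalar ::
    "('k::field \<Rightarrow> 'v::ab_group_add \<Rightarrow> 'v) \<Rightarrow> ('v \<Rightarrow> 'v \<Rightarrow> 'k) \<Rightarrow> 'k \<Rightarrow> ('v, 'k) free_algebra set" where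
  "cl_scalar scV B c = clifford_ideal scV B +>\<^bsub>free_ring\<^esub> free_scalar c"

lemma ring_free_ring: "ring (free_ring :: ('v, 'k::field) free_algebra ring)"
proof (rule ringI)
  show "abelian_group (free_ring :: ('v, 'k::field) free_algebra ring)"
  proof (rule abelian_groupI)
    fix x :: "('v, 'k) free_algebra"
    assume "x \<in> carrier free_ring"
    show "\<exists>y\<in>carrier free_ring. y \<oplus>\<^bsub>free_ring\<^esub> x = \<zero>\<^bsub>free_ring\<^esub>"
      by (rule bexI[of _ "- x"]) (simp_all add: free_ring_def)
  qed (simp_all add: free_ring_def algebra_simps)
  show "monoid (free_ring :: ('v, 'k::field) free_algebra ring)"
    by (rule monoidI) (simp_all add: free_ring_def mult.assoc)
qed (simp_all add: free_ring_def algebra_simps)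

lemma clifford_ideal_ideal: "ideal (clifford_ideal scV B) free_ring"
  unfolding clifford_ideal_def
  by (rule ring.genideal_ideal[OF ring_free_ring]) (simp add: free_ring_def)

lemma ring_clifford_algebra: "ring (clifford_algebra scV B)"
  unfolding clifford_algebra_def by (rule ideal.quotient_is_ring[OF clifford_ideal_ideal])

lemma clifford_coset_eqI:
  assumes "x - y \<in> clifford_relators scV B"
  shows "clifford_ideal scV B +>\<^bsub>free_ring\<^esub> x = clifford_ideal scV B +>\<^bsub>free_ring\<^esub> y"
proof -
  interpret ideal "clifford_ideal scV B" free_ring by (rule clifford_ideal_ideal)
  have "x - y \<in> clifford_ideal scV B"
    unfolding clifford_ideal_def
    by (rule subsetD[OF ring.genideal_self[OF ring_free_ring]]) (simp_all add: free_ring_def assms)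
  moreover have "x = (x - y) \<oplus>\<^bsub>free_ring\<^esub> y" by (simp add: free_ring_def)
  ultimately have "x \<in> clifford_ideal scV B +>\<^bsub>free_ring\<^esub> y"
    by (auto simp: a_r_coset_def')
  then show ?thesis
    by (rule a_repr_independence[symmetric]) (simp add: free_ring_def, rule a_subgroup)
qed

lemma clifford_coset_add:
  "(clifford_ideal scV B +>\<^bsub>free_ring\<^esub> x) \<oplus>\<^bsub>clifford_algebra scV B\<^esub> (clifford_ideal scV B +>\<^bsub>free_ring\<^esub> y)
     = clifford_ideal scV B +>\<^bsub>free_ring\<^esub> (x + y)"
proof -
  interpret ideal "clifford_ideal scV B" free_ring by (rule clifford_ideal_ideal)
  show ?thesis
    using a_rcos_sum[of x y]
    by (simp add: clifford_algebra_def FactRing_def free_ring_def)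
qed

lemma clifford_coset_mult:
  "(clifford_ideal scV B +>\<^bsub>free_ring\<^esub> x) \<otimes>\<^bsub>clifford_algebra scV B\<^esub> (clifford_ideal scV B +>\<^bsub>free_ring\<^esub> y)
     = clifford_ideal scV B +>\<^bsub>free_ring\<^esub> (x * y)"
proof -
  interpret ideal "clifford_ideal scV B" free_ring by (rule clifford_ideal_ideal)
  show ?thesis
    using rcoset_mult_add[of x y]
    by (simp add: clifford_algebra_def FactRing_def free_ring_def)
qed

lemma clifford_coset_carrier:
  "clifford_ideal scV B +>\<^bsub>free_ring\<^esub> x \<in> carrier (clifford_algebra scV B)"
  by (auto simp: clifford_algebra_def FactRing_def A_RCOSETS_def' free_ring_def)

lemma cl_vec_carrier: "cl_vec scV B v \<in> carrier (clifford_algebra scV B)"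
  unfolding cl_vec_def by (rule clifford_coset_carrier)

lemma cl_scalar_carrier: "cl_scalar scV B c \<in> carrier (clifford_algebra scV B)"
  unfolding cl_scalar_def by (rule clifford_coset_carrier)

lemma cl_vec_add:
  "cl_vec scV B (v + u) = cl_vec scV B v \<oplus>\<^bsub>clifford_algebra scV B\<^esub> cl_vec scV B u"
  unfolding cl_vec_def clifford_coset_add
  by (rule clifford_coset_eqI) (auto simp: clifford_relators_def)

lemma cl_vec_scale:
  "cl_vec scV B (scV c v) = cl_scalar scV B c \<otimes>\<^bsub>clifford_algebra scV B\<^esub> cl_vec scV B v"
  unfolding cl_vec_def cl_scalar_def clifford_coset_mult
  by (rule clifford_coset_eqI) (auto simp: clifford_relators_def)

lemma clifford_relation:
  "(cl_vec scV B v \<otimes>\<^bsub>clifford_algebra scV B\<^esub> cl_vec scV B u)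
     \<oplus>\<^bsub>clifford_algebra scV B\<^esub> (cl_vec scV B u \<otimes>\<^bsub>clifford_algebra scV B\<^esub> cl_vec scV B v)
   = cl_scalar scV B (- 2 * B v u)"
  unfolding cl_vec_def cl_scalar_def clifford_coset_mult clifford_coset_add
  by (rule clifford_coset_eqI) (auto simp: clifford_relators_def)


section \<open>Clifford modules and the spin representation\<close>

locale clifford_module =
  quadratic_space scV B + W: vector_space scW
  for scV :: "'k::field \<Rightarrow> 'v::ab_group_add \<Rightarrow> 'v"
    and B :: "'v \<Rightarrow> 'v \<Rightarrow> 'k"
    and scW :: "'k \<Rightarrow> 'w::ab_group_add \<Rightarrow> 'w" +
  fixes act :: "('v, 'k) free_algebra set \<Rightarrow> 'w \<Rightarrow> 'w"
  assumes W_nonzero: "\<exists>s::'w. s \<noteq> 0"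
    and W_fin_dim: "fin_dim scW UNIV"
    and act_add_right: "a \<in> carrier (clifford_algebra scV B) \<Longrightarrow> act a (s + t) = act a s + act a t"
    and act_add_left:
      "\<lbrakk>a \<in> carrier (clifford_algebra scV B); b \<in> carrier (clifford_algebra scV B)\<rbrakk> \<Longrightarrow>
         act (a \<oplus>\<^bsub>clifford_algebra scV B\<^esub> b) s = act a s + act b s"
    and act_mult:
      "\<lbrakk>a \<in> carrier (clifford_algebra scV B); b \<in> carrier (clifford_algebra scV B)\<rbrakk> \<Longrightarrow>
         act (a \<otimes>\<^bsub>clifford_algebra scV B\<^esub> b) s = act a (act b s)"
    and act_one: "act \<one>\<^bsub>clifford_algebra scV B\<^esub> s = s"
    and act_scalar: "act (cl_scalar scV B c) s = scW c s"

text \<open>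
  Since the elements \<open>so_elem scV B v u\<close> span the orthogonal Lie algebra, the last clause
  determines \<open>\<sigma>\<close> on it.
\<close>

definition spin_representation ::
    "('k::field \<Rightarrow> 'v::ab_group_add \<Rightarrow> 'v) \<Rightarrow> ('v \<Rightarrow> 'v \<Rightarrow> 'k) \<Rightarrow> ('k \<Rightarrow> 'w::ab_group_add \<Rightarrow> 'w) \<Rightarrow>
     (('v, 'k) free_algebra set \<Rightarrow> 'w \<Rightarrow> 'w) \<Rightarrow> (('v \<Rightarrow> 'v) \<Rightarrow> 'w \<Rightarrow> 'w) \<Rightarrow> bool" where
  "spin_representation scV B scW act \<sigma> \<longleftrightarrow>
     (\<forall>A\<in>so_algebra scV B. Vector_Spaces.linear scW scW (\<sigma> A)) \<and>
     (\<forall>A\<in>so_algebra scV B. \<forall>A'\<in>so_algebra scV B. \<forall>s.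
        \<sigma> (\<lambda>x. A x + A' x) s = \<sigma> A s + \<sigma> A' s) \<and>
     (\<forall>c. \<forall>A\<in>so_algebra scV B. \<forall>s. \<sigma> (\<lambda>x. scV c (A x)) s = scW c (\<sigma> A s)) \<and>
     (\<forall>A\<in>so_algebra scV B. \<forall>A'\<in>so_algebra scV B. \<forall>s.
        \<sigma> (\<lambda>x. A (A' x) - A' (A x)) s = \<sigma> A (\<sigma> A' s) - \<sigma> A' (\<sigma> A s)) \<and>
     (\<forall>v u s. \<sigma> (so_elem scV B v u) s =
        act (cl_scalar scV B (1 / 4) \<otimes>\<^bsub>clifford_algebra scV B\<^esub>
          ((cl_vec scV B v \<otimes>\<^bsub>clifford_algebra scV B\<^esub> cl_vec scV B u) \<ominus>\<^bsub>clifford_algebra scV B\<^esub>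
           (cl_vec scV B u \<otimes>\<^bsub>clifford_algebra scV B\<^esub> cl_vec scV B v))) s)"


section \<open>Extended translation algebras\<close>

locale extended_translation =
  clifford_module scV B scW act
  for scV :: "'k::field \<Rightarrow> 'v::ab_group_add \<Rightarrow> 'v"
    and B :: "'v \<Rightarrow> 'v \<Rightarrow> 'k"
    and scW :: "'k \<Rightarrow> 'w::ab_group_add \<Rightarrow> 'w"
    and act :: "('v, 'k) free_algebra set \<Rightarrow> 'w \<Rightarrow> 'w" +
  fixes \<sigma> :: "('v \<Rightarrow> 'v) \<Rightarrow> 'w \<Rightarrow> 'w"
    and \<epsilon> :: 'k
    and \<beta> :: "'w \<Rightarrow> 'w \<Rightarrow> 'k"
  assumes spin: "spin_representation scV B scW act \<sigma>"
    and \<beta>_bilinear: "bilinear_form scW \<beta>"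
    and \<beta>_nondegenerate: "nondegenerate_form \<beta>"
    and B1: "A \<in> so_algebra scV B \<Longrightarrow> \<beta> (\<sigma> A s) t + \<beta> s (\<sigma> A t) = 0"
    and B2: "(\<epsilon> = - 1 \<and> (\<forall>s t. \<beta> s t = \<beta> t s)) \<or> (\<epsilon> = 1 \<and> (\<forall>s t. \<beta> s t = - \<beta> t s))"
    and B3: "\<beta> (act (cl_vec scV B v) s) t = \<epsilon> * \<beta> s (act (cl_vec scV B v) t)"

text \<open>The bracket \<open>W \<times> W \<rightarrow> V\<close>, and the graded Lie algebra \<open>\<mm> = V + W\<close> on the product type.\<close>

definition et_bracket ::
    "('k::field \<Rightarrow> 'v::ab_group_add \<Rightarrow> 'v) \<Rightarrow> ('v \<Rightarrow> 'v \<Rightarrow> 'k) \<Rightarrow>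
     (('v, 'k) free_algebra set \<Rightarrow> 'w \<Rightarrow> 'w) \<Rightarrow> ('w \<Rightarrow> 'w \<Rightarrow> 'k) \<Rightarrow> 'w \<Rightarrow> 'w \<Rightarrow> 'v" where
  "et_bracket scV B act \<beta> s t = (THE x. \<forall>v. B x v = \<beta> (act (cl_vec scV B v) s) t)"

lemma (in quadratic_space) ex1_representing_vector:
  assumes f: "Vector_Spaces.linear scV (*) f"
  shows "\<exists>!x. \<forall>v. B x v = f v"
proof -
  obtain A where A: "finite A" "UNIV \<subseteq> span A"
    using V_fin_dim unfolding fin_dim_def by blast
  obtain E where E: "E \<subseteq> A" "independent E" "A \<subseteq> span E"
    using maximal_independent_subset[of A] by blast
  have finE: "finite E" using A E finite_subset by blast
  have spanE: "span E = UNIV"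
    using A(2) span_minimal[OF E(3) subspace_span] by blast
  interpret fd: finite_dimensional_vector_space scV E
    by unfold_locales (use finE E spanE in auto)
  interpret f: Vector_Spaces.linear scV "(*)" f by (rule f)
  have linL: "Vector_Spaces.linear scV (*) (\<lambda>x. B x y)" and linR: "Vector_Spaces.linear scV (*) (B x)" for x y
    using B_bilinear by (simp_all add: bilinear_form_def)
  have B_add: "B (x + x') y = B x y + B x' y" and B_scale: "B (scV c x) y = c * B x y" for x x' y c
    using linL[of y] by (simp_all add: Vector_Spaces.linear_iff)
  have ext: "g v = h v" if "Vector_Spaces.linear scV (*) g" "Vector_Spaces.linear scV (*) h"
    "\<And>b. b \<in> E \<Longrightarrow> g b = h b" for g h v
  proof -
    interpret gh: vector_space_pair scV "(*) :: 'k \<Rightarrow> 'k \<Rightarrow> 'k"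
      using that(1) unfolding Vector_Spaces.linear_def vector_space_pair_def by blast
    show ?thesis using gh.linear_eq_on[OF that(1,2), of v E] that(3) spanE by auto
  qed
  define T where "T x = (\<Sum>b\<in>E. scV (B x b) b)" for x
  have coeff: "\<forall>b\<in>E. c b = d b"
    if "(\<Sum>b\<in>E. scV (c b) b) = (\<Sum>b\<in>E. scV (d b) b)" for c d :: "'v \<Rightarrow> 'k"
  proof (rule ccontr)
    assume *: "\<not> ?thesis"
    have "(\<Sum>b\<in>E. scV (c b - d b) b) = 0"
      using that by (simp add: scale_left_diff_distrib sum_subtractf)
    then have "dependent E"
      unfolding dependent_explicit using finE * by (intro exI[of _ E] exI[of _ "\<lambda>b. c b - d b"]) auto
    then show False using E by blast
  qed
  have linT: "Vector_Spaces.linear scV scV T"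
  proof (unfold_locales)
    fix x y c
    show "T (x + y) = T x + T y"
      unfolding T_def
      by (simp add: B_add scale_left_distrib sum.distrib)
    show "T (scV c x) = scV c (T x)"
      unfolding T_def
      by (simp add: B_scale scale_sum_right)
  qed
  have inj: "inj T"
  proof (rule injI)
    fix x y assume "T x = T y"
    then have "\<forall>b\<in>E. B x b = B y b" unfolding T_def by (rule coeff)
    then have "B x v = B y v" for v using ext[OF linR linR] by blast
    then have "B (x - y) v = 0" for v
      using B_add[of "x - y" y v] by simp
    then show "x = y" using B_nondegenerate unfolding nondegenerate_form_def by force
  qed
  obtain x where "T x = (\<Sum>b\<in>E. scV (f b) b)"
    using fd.linear_inj_imp_surj[OF linT inj] by (metis surjD)
  then have "\<forall>b\<in>E. B x b = f b" unfolding T_def by (rule coeff)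
  then have x: "\<forall>v. B x v = f v" using ext[OF linR f] by blast
  moreover have "y = x" if "\<forall>v. B y v = f v" for y
  proof -
    have "T y = T x" unfolding T_def using that x by simp
    then show ?thesis using inj by (simp add: inj_def)
  qed
  ultimately show ?thesis by blast
qed

lemma (in clifford_module) act_vec_add:
  "act (cl_vec scV B (v + u)) s = act (cl_vec scV B v) s + act (cl_vec scV B u) s"
  by (simp add: cl_vec_add act_add_left cl_vec_carrier)

lemma (in clifford_module) act_vec_scale:
  "act (cl_vec scV B (scV c v)) s = scW c (act (cl_vec scV B v) s)"
  by (simp add: cl_vec_scale act_mult act_scalar cl_vec_carrier cl_scalar_carrier)

lemma (in extended_translation) et_bracket:
  "B (et_bracket scV B act \<beta> s t) v = \<beta> (act (cl_vec scV B v) s) t"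
proof -
  have lin\<beta>: "Vector_Spaces.linear scW (*) (\<lambda>x. \<beta> x y)" for y
    using \<beta>_bilinear by (simp add: bilinear_form_def)
  have "Vector_Spaces.linear scV (*) (\<lambda>v. \<beta> (act (cl_vec scV B v) s) t)"
    using vector_space_axioms lin\<beta>[of t]
    by (auto simp: Vector_Spaces.linear_iff act_vec_add act_vec_scale)
  from theI'[OF ex1_representing_vector[OF this]]
  show ?thesis unfolding et_bracket_def by blast
qed

definition m_scale ::
    "('k \<Rightarrow> 'v \<Rightarrow> 'v) \<Rightarrow> ('k \<Rightarrow> 'w \<Rightarrow> 'w) \<Rightarrow> 'k \<Rightarrow> 'v \<times> 'w \<Rightarrow> 'v \<times> 'w" where
  "m_scale scV scW c x = (scV c (fst x), scW c (snd x))"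

definition m_component :: "int \<Rightarrow> ('v::zero \<times> 'w::zero) set" where
  "m_component p = (if p = - 2 then UNIV \<times> {0} else if p = - 1 then {0} \<times> UNIV else {0})"

definition m_bracket ::
    "('k::field \<Rightarrow> 'v::ab_group_add \<Rightarrow> 'v) \<Rightarrow> ('v \<Rightarrow> 'v \<Rightarrow> 'k) \<Rightarrow>
     (('v, 'k) free_algebra set \<Rightarrow> 'w::ab_group_add \<Rightarrow> 'w) \<Rightarrow> ('w \<Rightarrow> 'w \<Rightarrow> 'k) \<Rightarrow>
     'v \<times> 'w \<Rightarrow> 'v \<times> 'w \<Rightarrow> 'v \<times> 'w" where
  "m_bracket scV B act \<beta> x y = (et_bracket scV B act \<beta> (snd x) (snd y), 0)"


section \<open>Graded Lie algebras and prolongations\<close>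

text \<open>
  A graded Lie algebra is given by its components \<open>G p\<close>, independent subspaces of an ambient vector
  space; the algebra itself is their sum, and the bracket is constrained on that sum only.
\<close>

definition total_space ::
    "('k::field \<Rightarrow> 'g::ab_group_add \<Rightarrow> 'g) \<Rightarrow> (int \<Rightarrow> 'g set) \<Rightarrow> 'g set" where
  "total_space scale G = module.span scale (\<Union>p. G p)"

locale graded_lie_algebra = vector_space scale
  for scale :: "'k::field \<Rightarrow> 'g::ab_group_add \<Rightarrow> 'g" +
  fixes G :: "int \<Rightarrow> 'g set"
    and br :: "'g \<Rightarrow> 'g \<Rightarrow> 'g"
  assumes component_subspace: "subspace (G p)"
    and component_independent:
      "\<lbrakk>finite P; \<And>p. p \<in> P \<Longrightarrow> x p \<in> G p; (\<Sum>p\<in>P. x p) = 0\<rbrakk> \<Longrightarrow> \<forall>p\<in>P. x p = 0"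
    and br_graded: "\<lbrakk>X \<in> G p; Y \<in> G q\<rbrakk> \<Longrightarrow> br X Y \<in> G (p + q)"
    and br_add_left:
      "\<lbrakk>X \<in> total_space scale G; Y \<in> total_space scale G; Z \<in> total_space scale G\<rbrakk> \<Longrightarrow>
         br (X + Y) Z = br X Z + br Y Z"
    and br_add_right:
      "\<lbrakk>X \<in> total_space scale G; Y \<in> total_space scale G; Z \<in> total_space scale G\<rbrakk> \<Longrightarrow>
         br X (Y + Z) = br X Y + br X Z"
    and br_scale_left:
      "\<lbrakk>X \<in> total_space scale G; Y \<in> total_space scale G\<rbrakk> \<Longrightarrow> br (scale c X) Y = scale c (br X Y)"
    and br_scale_right:
      "\<lbrakk>X \<in> total_space scale G; Y \<in> total_space scale G\<rbrakk> \<Longrightarrow> br X (scale c Y) = scale c (br X Y)"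
    and br_alternating: "X \<in> total_space scale G \<Longrightarrow> br X X = 0"
    and br_jacobi:
      "\<lbrakk>X \<in> total_space scale G; Y \<in> total_space scale G; Z \<in> total_space scale G\<rbrakk> \<Longrightarrow>
         br X (br Y Z) + br Y (br Z X) + br Z (br X Y) = 0"

definition graded_lie_hom ::
    "('k::field \<Rightarrow> 'g::ab_group_add \<Rightarrow> 'g) \<Rightarrow> (int \<Rightarrow> 'g set) \<Rightarrow> ('g \<Rightarrow> 'g \<Rightarrow> 'g) \<Rightarrow>
     ('k \<Rightarrow> 'h::ab_group_add \<Rightarrow> 'h) \<Rightarrow> (int \<Rightarrow> 'h set) \<Rightarrow> ('h \<Rightarrow> 'h \<Rightarrow> 'h) \<Rightarrow> ('g \<Rightarrow> 'h) \<Rightarrow> bool" where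
  "graded_lie_hom sc G br sc' G' br' f \<longleftrightarrow>
     (\<forall>X\<in>total_space sc G. \<forall>Y\<in>total_space sc G. f (X + Y) = f X + f Y) \<and>
     (\<forall>c. \<forall>X\<in>total_space sc G. f (sc c X) = sc' c (f X)) \<and>
     (\<forall>p. f ` G p \<subseteq> G' p) \<and>
     (\<forall>X\<in>total_space sc G. \<forall>Y\<in>total_space sc G. f (br X Y) = br' (f X) (f Y))"

definition graded_lie_embedding ::
    "('k::field \<Rightarrow> 'g::ab_group_add \<Rightarrow> 'g) \<Rightarrow> (int \<Rightarrow> 'g set) \<Rightarrow> ('g \<Rightarrow> 'g \<Rightarrow> 'g) \<Rightarrow>
     ('k \<Rightarrow> 'h::ab_group_add \<Rightarrow> 'h) \<Rightarrow> (int \<Rightarrow> 'h set) \<Rightarrow> ('h \<Rightarrow> 'h \<Rightarrow> 'h) \<Rightarrow> ('g \<Rightarrow> 'h) \<Rightarrow> bool" where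
  "graded_lie_embedding sc G br sc' G' br' f \<longleftrightarrow>
     graded_lie_hom sc G br sc' G' br' f \<and> inj_on f (total_space sc G)"

text \<open>
  The identification of the negative part with \<open>\<mm>\<close> is an embedding of \<open>\<mm>\<close> whose image is
  exactly the negative part.
\<close>

definition transitive_prolongation ::
    "('k::field \<Rightarrow> 'v::ab_group_add \<Rightarrow> 'v) \<Rightarrow> ('v \<Rightarrow> 'v \<Rightarrow> 'k) \<Rightarrow>
     ('k \<Rightarrow> 'w::ab_group_add \<Rightarrow> 'w) \<Rightarrow> (('v, 'k) free_algebra set \<Rightarrow> 'w \<Rightarrow> 'w) \<Rightarrow> ('w \<Rightarrow> 'w \<Rightarrow> 'k) \<Rightarrow>
     ('k \<Rightarrow> 'g::ab_group_add \<Rightarrow> 'g) \<Rightarrow> (int \<Rightarrow> 'g set) \<Rightarrow> ('g \<Rightarrow> 'g \<Rightarrow> 'g) \<Rightarrow> bool" where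
  "transitive_prolongation scV B scW act \<beta> sc G br \<longleftrightarrow>
     graded_lie_algebra sc G br \<and>
     (\<forall>p. fin_dim sc (G p)) \<and>
     (\<exists>\<iota>. graded_lie_embedding (m_scale scV scW) m_component (m_bracket scV B act \<beta>) sc G br \<iota> \<and>
          (\<forall>p<0. \<iota> ` m_component p = G p)) \<and>
     (\<forall>p\<ge>0. \<forall>X\<in>G p. (\<forall>Y\<in>G (- 1). br X Y = 0) \<longrightarrow> X = 0)"

text \<open>
  Maximality quantifies over competitors \<open>\<gg>'\<close> realised inside \<open>'k poly\<close>, a vector space of
  countably infinite dimension. Every graded Lie algebra with finite-dimensional components has
  countable dimension, so this is no restriction: see \<open>maximal_transitive_prolongationD\<close> below,
  where the competitor has an arbitrary type.
\<close>

definition maximal_transitive_prolongation ::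
    "('k::field \<Rightarrow> 'v::ab_group_add \<Rightarrow> 'v) \<Rightarrow> ('v \<Rightarrow> 'v \<Rightarrow> 'k) \<Rightarrow>
     ('k \<Rightarrow> 'w::ab_group_add \<Rightarrow> 'w) \<Rightarrow> (('v, 'k) free_algebra set \<Rightarrow> 'w \<Rightarrow> 'w) \<Rightarrow> ('w \<Rightarrow> 'w \<Rightarrow> 'k) \<Rightarrow>
     ('k \<Rightarrow> 'g::ab_group_add \<Rightarrow> 'g) \<Rightarrow> (int \<Rightarrow> 'g set) \<Rightarrow> ('g \<Rightarrow> 'g \<Rightarrow> 'g) \<Rightarrow> bool" where
  "maximal_transitive_prolongation scV B scW act \<beta> sc G br \<longleftrightarrow>
     transitive_prolongation scV B scW act \<beta> sc G br \<and>
     (\<forall>(G' :: int \<Rightarrow> 'k poly set) br'.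
        transitive_prolongation scV B scW act \<beta> smult G' br' \<longrightarrow>
        (\<exists>f. graded_lie_embedding smult G' br' sc G br f))"

lemma vector_space_smult: "vector_space (smult :: 'k::field \<Rightarrow> 'k poly \<Rightarrow> 'k poly)"
  by unfold_locales (simp_all add: smult_add_right smult_add_left)

context graded_lie_algebra
begin

lemma subspace_total: "subspace (total_space scale G)"
  unfolding total_space_def by (rule subspace_span)

lemma component_in_total: "X \<in> G p \<Longrightarrow> X \<in> total_space scale G"
  unfolding total_space_def by (rule span_base) blast

lemma br_closed:
  assumes X: "X \<in> total_space scale G" and Y: "Y \<in> total_space scale G"
  shows "br X Y \<in> total_space scale G"
proof -
  have br0: "br X 0 = 0" "br 0 X = 0" if "X \<in> total_space scale G" for X
    using br_scale_right[OF that that, of 0] br_scale_left[OF that that, of 0] by simp_all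
  have 1: "Y \<in> total_space scale G \<and> br X Y \<in> total_space scale G"
    if "X \<in> G p" "Y \<in> total_space scale G" for X Y p
    using that(2)[unfolded total_space_def]
  proof (induction rule: span_induct_alt)
    case base
    show ?case using br0(1)[OF component_in_total[OF that(1)]] subspace_total by (simp add: subspace_0)
  next
    case (step c x y)
    then obtain q where q: "x \<in> G q" by blast
    have x: "x \<in> total_space scale G" by (rule component_in_total[OF q])
    have "br X (scale c x + y) = scale c (br X x) + br X y"
      using component_in_total[OF that(1)] x step subspace_total
      by (simp add: br_add_right br_scale_right subspace_scale)
    moreover have "br X x \<in> total_space scale G"
      by (rule component_in_total[OF br_graded[OF that(1) q]])
    ultimately show ?case using x step subspace_total by (simp add: subspace_add subspace_scale)
  qed
  have "X \<in> total_space scale G \<and> br X Y \<in> total_space scale G"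
    using X[unfolded total_space_def]
  proof (induction rule: span_induct_alt)
    case base
    show ?case using br0(2)[OF Y] subspace_total by (simp add: subspace_0)
  next
    case (step c x y)
    then obtain q where q: "x \<in> G q" by blast
    have x: "x \<in> total_space scale G" by (rule component_in_total[OF q])
    have "br (scale c x + y) Y = scale c (br x Y) + br y Y"
      using Y x step subspace_total
      by (simp add: br_add_left br_scale_left subspace_scale)
    then show ?case using x step 1[OF q Y] subspace_total by (simp add: subspace_add subspace_scale)
  qed
  then show ?thesis by blast
qed

end

lemma vector_space_m_scale:
  assumes "vector_space scV" "vector_space scW"
  shows "vector_space (m_scale scV scW)"
proof -
  interpret V: vector_space scV by fact
  interpret W: vector_space scW by fact
  show ?thesis
    by unfold_locales
      (simp_all add: m_scale_def prod_eq_iff V.scale_right_distrib V.scale_left_distrib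
        W.scale_right_distrib W.scale_left_distrib)
qed

lemma graded_lie_hom_total:
  assumes "vector_space sc" "vector_space sc'"
    and hom: "graded_lie_hom sc G br sc' G' br' f"
    and X: "X \<in> total_space sc G"
  shows "f X \<in> total_space sc' G'"
proof -
  interpret V: vector_space sc by fact
  interpret W: vector_space sc' by fact
  have f_add: "\<And>X Y. \<lbrakk>X \<in> total_space sc G; Y \<in> total_space sc G\<rbrakk> \<Longrightarrow> f (X + Y) = f X + f Y"
    and f_scale: "\<And>c X. X \<in> total_space sc G \<Longrightarrow> f (sc c X) = sc' c (f X)"
    and f_G: "\<And>p X. X \<in> G p \<Longrightarrow> f X \<in> G' p"
    using hom unfolding graded_lie_hom_def by blast+
  have sub: "V.subspace (total_space sc G)" "W.subspace (total_space sc' G')"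
    unfolding total_space_def by (rule V.subspace_span, rule W.subspace_span)
  have "X \<in> total_space sc G \<and> f X \<in> total_space sc' G'"
    using X[unfolded total_space_def]
  proof (induction rule: V.span_induct_alt)
    case base
    have "f 0 = 0" using f_scale[OF V.subspace_0[OF sub(1)], of 0] by simp
    then show ?case using sub by (simp add: V.subspace_0 W.subspace_0)
  next
    case (step c x y)
    have x: "x \<in> total_space sc G" unfolding total_space_def using step by (blast intro: V.span_base)
    have fx: "f x \<in> total_space sc' G'"
      unfolding total_space_def using step f_G by (blast intro: W.span_base)
    have "f (sc c x + y) = sc' c (f x) + f y"
      using x step sub by (simp add: V.subspace_scale f_add f_scale)
    then show ?case using x fx step sub
      by (simp add: V.subspace_scale V.subspace_add W.subspace_scale W.subspace_add)
  qed
  then show ?thesis by blast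
qed

lemma graded_lie_embeddingD:
  assumes "graded_lie_embedding sc G br sc' G' br' f"
  shows "graded_lie_hom sc G br sc' G' br' f"
    and "\<lbrakk>X \<in> total_space sc G; Y \<in> total_space sc G\<rbrakk> \<Longrightarrow> f (X + Y) = f X + f Y"
    and "X \<in> total_space sc G \<Longrightarrow> f (sc c X) = sc' c (f X)"
    and "f ` G p \<subseteq> G' p"
    and "\<lbrakk>X \<in> total_space sc G; Y \<in> total_space sc G\<rbrakk> \<Longrightarrow> f (br X Y) = br' (f X) (f Y)"
    and "inj_on f (total_space sc G)"
  using assms by (simp_all add: graded_lie_embedding_def graded_lie_hom_def)

lemma graded_lie_embedding_compose:
  assumes "vector_space sc" "vector_space sc'"
    and f: "graded_lie_embedding sc G br sc' G' br' f"
    and g: "graded_lie_embedding sc' G' br' sc'' G'' br'' g"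
  shows "graded_lie_embedding sc G br sc'' G'' br'' (\<lambda>x. g (f x))"
proof -
  have tot: "f X \<in> total_space sc' G'" if "X \<in> total_space sc G" for X
    by (rule graded_lie_hom_total[OF assms(1,2) graded_lie_embeddingD(1)[OF f] that])
  show ?thesis
    unfolding graded_lie_embedding_def graded_lie_hom_def
  proof (intro conjI allI ballI)
    show "(\<lambda>x. g (f x)) ` G p \<subseteq> G'' p" for p
      using graded_lie_embeddingD(4)[OF f, of p] graded_lie_embeddingD(4)[OF g, of p] by blast
    show "inj_on (\<lambda>x. g (f x)) (total_space sc G)"
      using graded_lie_embeddingD(6)[OF f] graded_lie_embeddingD(6)[OF g] tot
      by (auto simp: inj_on_def)
  qed (simp_all add: tot graded_lie_embeddingD(2,3,5)[OF f] graded_lie_embeddingD(2,3,5)[OF g])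
qed

lemma transitive_prolongationD:
  assumes "transitive_prolongation scV B scW act \<beta> sc G br"
  shows "graded_lie_algebra sc G br"
    and "fin_dim sc (G p)"
    and "\<exists>\<iota>. graded_lie_embedding (m_scale scV scW) m_component (m_bracket scV B act \<beta>) sc G br \<iota> \<and>
          (\<forall>p<0. \<iota> ` m_component p = G p)"
    and "\<lbrakk>p \<ge> 0; X \<in> G p; \<And>Y. Y \<in> G (- 1) \<Longrightarrow> br X Y = 0\<rbrakk> \<Longrightarrow> X = 0"
  using assms by (simp_all add: transitive_prolongation_def)

lemma transitive_prolongationI:
  assumes "graded_lie_algebra sc G br"
    and "\<And>p. fin_dim sc (G p)"
    and "graded_lie_embedding (m_scale scV scW) m_component (m_bracket scV B act \<beta>) sc G br \<iota>"
    and "\<And>p. p < 0 \<Longrightarrow> \<iota> ` m_component p = G p"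
    and "\<And>p X. \<lbrakk>p \<ge> 0; X \<in> G p; \<forall>Y\<in>G (- 1). br X Y = 0\<rbrakk> \<Longrightarrow> X = 0"
  shows "transitive_prolongation scV B scW act \<beta> sc G br"
  unfolding transitive_prolongation_def
  by (intro conjI allI impI ballI exI[of _ \<iota>]) (fact assms | erule (2) assms(5) | erule assms(4))+

text \<open>A transitive prolongation can be transported along an injective linear map.\<close>

lemma transitive_prolongation_transport:
  fixes sc :: "'k::field \<Rightarrow> 'g::ab_group_add \<Rightarrow> 'g" and sc' :: "'k \<Rightarrow> 'h::ab_group_add \<Rightarrow> 'h"
  assumes V: "vector_space scV" and W: "vector_space scW"
    and tp: "transitive_prolongation scV B scW act \<beta> sc G br"
    and lin: "Vector_Spaces.linear sc sc' \<phi>"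
    and inj: "inj_on \<phi> (total_space sc G)"
  obtains br' where "transitive_prolongation scV B scW act \<beta> sc' (\<lambda>p. \<phi> ` G p) br'"
    and "graded_lie_embedding sc G br sc' (\<lambda>p. \<phi> ` G p) br' \<phi>"
proof -
  interpret g: graded_lie_algebra sc G br by (rule transitive_prolongationD(1)[OF tp])
  interpret lin: Vector_Spaces.linear sc sc' \<phi> by (rule lin)
  let ?L = "total_space sc G" and ?G = "\<lambda>p. \<phi> ` G p"
  define \<psi> where "\<psi> = inv_into ?L \<phi>"
  define br' where "br' x y = \<phi> (br (\<psi> x) (\<psi> y))" for x y
  have \<psi>[simp]: "\<psi> (\<phi> x) = x" if "x \<in> ?L" for x
    unfolding \<psi>_def using inj that by (rule inv_into_f_f)
  have L': "total_space sc' ?G = \<phi> ` ?L"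
    unfolding total_space_def by (simp add: lin.span_image[symmetric] image_UN)
  note closed [simp] = g.br_closed
    g.subspace_total[THEN g.subspace_add] g.subspace_total[THEN g.subspace_scale]
  have br'[simp]: "br' (\<phi> x) (\<phi> y) = \<phi> (br x y)" if "x \<in> ?L" "y \<in> ?L" for x y
    unfolding br'_def using that by simp
  have gla: "graded_lie_algebra sc' ?G br'"
  proof unfold_locales
    show "lin.vs2.subspace (?G p)" for p
      by (rule lin.subspace_image[OF g.component_subspace])
    show "\<forall>p\<in>P. x p = 0" if P: "finite P" "\<And>p. p \<in> P \<Longrightarrow> x p \<in> ?G p" "(\<Sum>p\<in>P. x p) = 0" for P x
    proof -
      have "\<forall>p\<in>P. \<exists>y. y \<in> G p \<and> x p = \<phi> y" using P(2) by blast
      then obtain y where y: "\<And>p. p \<in> P \<Longrightarrow> y p \<in> G p \<and> x p = \<phi> (y p)" by metis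
      have "\<phi> (\<Sum>p\<in>P. y p) = 0" using P(3) y by (simp add: lin.sum)
      moreover have "(\<Sum>p\<in>P. y p) \<in> ?L"
        by (rule g.subspace_sum[OF g.subspace_total]) (use y g.component_in_total in blast)
      ultimately have "(\<Sum>p\<in>P. y p) = 0"
        using inj lin.zero g.subspace_0[OF g.subspace_total] by (metis inj_onD)
      then show ?thesis using g.component_independent[OF P(1), of y] y lin.zero by metis
    qed
    show "br' X Y \<in> ?G (p + q)" if "X \<in> ?G p" "Y \<in> ?G q" for X Y p q
    proof -
      obtain x y where "x \<in> G p" "y \<in> G q" "X = \<phi> x" "Y = \<phi> y" using \<open>X \<in> ?G p\<close> \<open>Y \<in> ?G q\<close> by blast
      then show ?thesis
        using g.br_graded[of x p y q] g.component_in_total[of x p] g.component_in_total[of y q] by simp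
    qed
    show "br' X (br' Y Z) + br' Y (br' Z X) + br' Z (br' X Y) = 0"
      if XYZ: "X \<in> total_space sc' ?G" "Y \<in> total_space sc' ?G" "Z \<in> total_space sc' ?G" for X Y Z
    proof -
      obtain x y z where "x \<in> ?L" "y \<in> ?L" "z \<in> ?L" "X = \<phi> x" "Y = \<phi> y" "Z = \<phi> z"
        using XYZ unfolding L' by blast
      then show ?thesis
        using g.br_jacobi[of x y z] by (simp only: br' closed lin.add[symmetric] lin.zero)
    qed
  next
    fix X Y Z
    assume XYZ: "X \<in> total_space sc' ?G" "Y \<in> total_space sc' ?G" "Z \<in> total_space sc' ?G"
    then obtain x y z where xyz: "x \<in> ?L" "y \<in> ?L" "z \<in> ?L" "X = \<phi> x" "Y = \<phi> y" "Z = \<phi> z"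
      unfolding L' by blast
    show "br' (X + Y) Z = br' X Z + br' Y Z" "br' X (Y + Z) = br' X Y + br' X Z"
      unfolding xyz using xyz(1-3)
      by (simp_all only: br' closed g.br_add_left g.br_add_right lin.add[symmetric])
  next
    fix X Y c
    assume XYZ: "X \<in> total_space sc' ?G" "Y \<in> total_space sc' ?G"
    then obtain x y where xyz: "x \<in> ?L" "y \<in> ?L" "X = \<phi> x" "Y = \<phi> y"
      unfolding L' by blast
    show "br' (sc' c X) Y = sc' c (br' X Y)" "br' X (sc' c Y) = sc' c (br' X Y)"
      unfolding xyz using xyz(1,2)
      by (simp_all only: br' closed g.br_scale_left g.br_scale_right lin.scale[symmetric])
  next
    fix X assume "X \<in> total_space sc' ?G"
    then obtain x where "x \<in> ?L" "X = \<phi> x"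
      unfolding L' by blast
    then show "br' X X = 0" by (simp add: g.br_alternating lin.zero)
  qed
  have emb: "graded_lie_embedding sc G br sc' ?G br' \<phi>"
    unfolding graded_lie_embedding_def graded_lie_hom_def
    by (intro conjI allI ballI inj) (simp_all add: lin.add lin.scale)
  obtain \<iota> where \<iota>: "graded_lie_embedding (m_scale scV scW) m_component (m_bracket scV B act \<beta>) sc G br \<iota>"
    and \<iota>_image: "\<forall>p<0. \<iota> ` m_component p = G p"
    using transitive_prolongationD(3)[OF tp]
    by (elim exE conjE)
  show ?thesis
  proof (rule that[OF _ emb])
    have fin: "fin_dim sc' (?G p)" for p
    proof -
      obtain A where "finite A" "G p \<subseteq> g.span A"
        using transitive_prolongationD(2)[OF tp, of p] unfolding fin_dim_def by blast
      then show ?thesis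
        unfolding fin_dim_def by (intro exI[of _ "\<phi> ` A"]) (auto simp: lin.span_image)
    qed
    have trans: "X = 0" if p: "p \<ge> 0" and X: "X \<in> ?G p" "\<forall>Y\<in>?G (- 1). br' X Y = 0" for p X
    proof -
      obtain x where x: "x \<in> G p" "X = \<phi> x" using X by blast
      have "br x y = 0" if y: "y \<in> G (- 1)" for y
      proof -
        have "x \<in> ?L" "y \<in> ?L" using x y g.component_in_total by blast+
        then have "\<phi> (br x y) = \<phi> 0" using X(2) x y lin.zero by auto
        then show ?thesis
          by (rule inj_onD[OF inj]) (use \<open>x \<in> ?L\<close> \<open>y \<in> ?L\<close> g.subspace_0[OF g.subspace_total] in simp_all)
      qed
      then have "x = 0" by (rule transitive_prolongationD(4)[OF tp p x(1)])
      then show ?thesis using x lin.zero by simp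
    qed
    have emb': "graded_lie_embedding (m_scale scV scW) m_component (m_bracket scV B act \<beta>)
        sc' ?G br' (\<lambda>x. \<phi> (\<iota> x))"
      by (rule graded_lie_embedding_compose[OF vector_space_m_scale[OF V W] _ \<iota> emb]) unfold_locales
    have image: "(\<lambda>x. \<phi> (\<iota> x)) ` m_component p = ?G p" if "p < 0" for p
      unfolding image_image[symmetric] using \<iota>_image that by simp
    show "transitive_prolongation scV B scW act \<beta> sc' ?G br'"
      by (rule transitive_prolongationI[OF gla fin emb' image trans])
  qed
qed

lemma maximal_transitive_prolongationD:
  fixes sc' :: "'k::field \<Rightarrow> 'h::ab_group_add \<Rightarrow> 'h"
  assumes V: "vector_space scV" and W: "vector_space scW"
    and max: "maximal_transitive_prolongation scV B scW act \<beta> sc G br"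
    and tp: "transitive_prolongation scV B scW act \<beta> sc' G' br'"
  shows "\<exists>f. graded_lie_embedding sc' G' br' sc G br f"
proof -
  interpret g: graded_lie_algebra sc' G' br' by (rule transitive_prolongationD(1)[OF tp])
  interpret P: vector_space "smult :: 'k \<Rightarrow> 'k poly \<Rightarrow> 'k poly" by (rule vector_space_smult)
  interpret gP: vector_space_pair sc' "smult :: 'k \<Rightarrow> 'k poly \<Rightarrow> 'k poly" by unfold_locales
  have "\<forall>p. \<exists>A. finite A \<and> G' p \<subseteq> g.span A"
    using transitive_prolongationD(2)[OF tp] unfolding fin_dim_def by blast
  then obtain A where A: "\<And>p. finite (A p)" "\<And>p. G' p \<subseteq> g.span (A p)" by metis
  obtain E where E: "E \<subseteq> (\<Union>p. A p)" "g.independent E" "(\<Union>p. A p) \<subseteq> g.span E"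
    using g.maximal_independent_subset by blast
  have "countable (\<Union>p. A p)" using A(1) by (auto intro: countable_finite)
  then have countE: "countable E" using E(1) countable_subset by blast
  have "g.span (A p) \<subseteq> g.span E" for p
    by (rule g.span_minimal) (use E(3) in auto)
  then have "(\<Union>p. G' p) \<subseteq> g.span E" using A(2) by blast
  then have total: "total_space sc' G' \<subseteq> g.span E"
    unfolding total_space_def by (rule g.span_minimal) simp
  define e where "e b = (monom 1 (to_nat_on E b) :: 'k poly)" for b
  define \<phi> where "\<phi> = gP.construct E e"
  have lin: "Vector_Spaces.linear sc' smult \<phi>"
    unfolding \<phi>_def by (rule gP.linear_construct[OF E(2)])
  have \<phi>_e: "\<phi> b = e b" if "b \<in> E" for b
    unfolding \<phi>_def by (rule gP.construct_basis[OF E(2) that])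
  have inj_n: "inj_on (to_nat_on E) E" using countE by (rule inj_on_to_nat_on)
  have inj_e: "inj_on e E"
    using inj_n unfolding e_def inj_on_def by (metis monom_eq_iff' one_neq_zero)
  have "P.independent (e ` E)"
    unfolding P.dependent_explicit
  proof clarify
    fix T u v assume T: "finite T" "T \<subseteq> e ` E" and 0: "(\<Sum>x\<in>T. smult (u x) x) = 0"
      and v: "v \<in> T" "u v \<noteq> 0"
    obtain b where b: "b \<in> E" "v = e b" using T v by blast
    have "0 = coeff (\<Sum>x\<in>T. smult (u x) x) (to_nat_on E b)" by (simp add: 0)
    also have "\<dots> = (\<Sum>x\<in>T. u x * coeff x (to_nat_on E b))" by (simp add: coeff_sum)
    also have "\<dots> = (\<Sum>x\<in>T. if x = v then u v else 0)"
    proof (rule sum.cong[OF refl])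
      fix x assume "x \<in> T"
      then obtain b' where b': "b' \<in> E" "x = e b'" using T by blast
      show "u x * coeff x (to_nat_on E b) = (if x = v then u v else 0)"
        using b b' inj_n inj_e by (auto simp: e_def inj_on_def)
    qed
    also have "\<dots> = u v" using T v by simp
    finally show False using v by simp
  qed
  then have "P.independent (\<phi> ` E)" and "inj_on \<phi> E"
    using \<phi>_e inj_e by (simp_all cong: image_cong inj_on_cong)
  then have "inj_on \<phi> (g.span E)"
    using gP.linear_inj_on_span_independent_image[OF lin] by blast
  then have inj: "inj_on \<phi> (total_space sc' G')" using total inj_on_subset by blast
  obtain br'' where tp'': "transitive_prolongation scV B scW act \<beta> smult (\<lambda>p. \<phi> ` G' p) br''"
    and emb: "graded_lie_embedding sc' G' br' smult (\<lambda>p. \<phi> ` G' p) br'' \<phi>"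
    by (rule transitive_prolongation_transport[OF V W tp lin inj])
  obtain f where "graded_lie_embedding smult (\<lambda>p. \<phi> ` G' p) br'' sc G br f"
    using max[unfolded maximal_transitive_prolongation_def, THEN conjunct2, rule_format, OF tp'']
    by (elim exE)
  from graded_lie_embedding_compose[OF g.vector_space_axioms P.vector_space_axioms emb this]
  show ?thesis by (rule exI[where x = "\<lambda>x. f (\<phi> x)"])
qed

end

theory Submission
  imports Defs
begin

text \<open>
  Write \<open>v s\<close> for Clifford multiplication and let \<open>A\<close> be an element of \<open>\<gg>\<^sub>0\<close>, regarded as a derivation
  of \<open>\<mm> = V + W\<close>. Everything rests on two facts about \<open>\<gg>\<^sub>0\<close>.

  If \<open>A\<close> kills \<open>V\<close>, then, with respect to \<open>\<beta>\<close>, Clifford multiplication by \<open>v\<close> turns \<open>A\<close> into minus its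
  adjoint for every \<open>v\<close>, and therefore \<open>A\<close> commutes with the products \<open>v u\<close> of orthogonal vectors
  (\<open>derivation_killing_V_commutes\<close>). The first prolongation of such derivations vanishes: a symmetric
  map \<open>T\<close> with \<open>T(s)\<close> of this kind satisfies \<open>a b T(s)t = T(a s)(b t) = b a T(s)t\<close>, but
  \<open>a = e\<^sub>1 e\<^sub>2\<close> and \<open>b = e\<^sub>2 e\<^sub>3\<close> are invertible and anticommute; this is where \<open>dim V \<ge> 3\<close> enters
  (\<open>first_prolongation_killing_V_zero\<close>). So an element of \<open>\<gg>\<^sub>1\<close> that kills \<open>V\<close> is zero, and
  transitivity carries this to every positive degree, since \<open>V\<close> commutes with \<open>W\<close>
  (\<open>positive_degree_transitive_V\<close>). This is the second claim.

  In general, \<open>A\<close> acts on \<open>V\<close> as an element of the conformal algebra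
  (\<open>derivation_pair_conformal\<close>), whose second prolongation is zero when \<open>dim V \<ge> 3\<close>
  (\<open>conformal_second_prolongation_zero\<close>). Bracketing an element of \<open>\<gg>\<^sub>4\<close> with three vectors of \<open>V\<close>
  gives an element of that prolongation, hence zero. For \<open>X\<close> in \<open>\<gg>\<^sub>5\<close> the bracket with three vectors
  is some \<open>f\<close> in \<open>W\<close>, and \<open>[f,s]\<close> comes from \<open>[X,s]\<close> in \<open>\<gg>\<^sub>4\<close>, so \<open>[f,s] = 0\<close> for all \<open>s\<close> and \<open>f = 0\<close>.
  The second claim, used three times, then gives \<open>X = 0\<close>. Now \<open>\<gg>\<^sub>5 = 0\<close>, transitivity
  forces \<open>\<gg>\<^sub>p = 0\<close> for all \<open>p \<ge> 5\<close>, and only finitely many finite-dimensional components remain.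

  The ground field enters through the invertibility of \<open>2\<close> and \<open>3\<close>.
\<close>

section \<open>Orthogonal vectors in a quadratic space\<close>

lemma bilinear_formD:
  assumes "bilinear_form scale b"
  shows "b (x + x') y = b x y + b x' y" "b (scale c x) y = c * b x y"
    and "b x (y + y') = b x y + b x y'" "b x (scale c y) = c * b x y"
    and "b 0 y = 0" "b x 0 = 0"
    and "b (- x) y = - b x y" "b x (- y) = - b x y"
    and "b (x - x') y = b x y - b x' y" "b x (y - y') = b x y - b x y'"
proof -
  show add: "b (x + x') y = b x y + b x' y" and "b (scale c x) y = c * b x y"
    and add': "b x (y + y') = b x y + b x y'" and "b x (scale c y) = c * b x y" for x x' y y' c
    using assms by (simp_all add: bilinear_form_def Vector_Spaces.linear_iff)
  show "b 0 y = 0" "b x 0 = 0" for x y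
    using add[of 0 0 y] add'[of x 0 0] by (metis add_0 add_cancel_left_left)+
  then show "b (- x) y = - b x y" "b x (- y) = - b x y" for x y
    using add[of x "- x" y] add'[of x y "- y"] by (simp_all add: eq_neg_iff_add_eq_0 add.commute)
  show "b (x - x') y = b x y - b x' y" "b x (y - y') = b x y - b x y'"
    unfolding eq_diff_eq using add[of "x - x'" x' y] add'[of x "y - y'" y'] by simp_all
qed

context quadratic_space
begin

lemmas B_simps = bilinear_formD[OF B_bilinear]

lemma B_eqI: "(\<And>v. B x v = B y v) \<Longrightarrow> x = y"
  using B_nondegenerate B_simps(9)[of x y] unfolding nondegenerate_form_def
  by (metis eq_iff_diff_eq_0)

text \<open>
  One step of Gram--Schmidt. The form is nondegenerate on the orthogonal complement of \<open>E\<close>, so that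
  complement contains a pair \<open>x, y\<close> with \<open>B x y \<noteq> 0\<close>, and then one of \<open>x\<close>, \<open>y\<close>, \<open>x + y\<close>
  is nonisotropic.
\<close>

lemma exists_orthogonal_nonisotropic:
  assumes two: "(2::'k) \<noteq> 0" and fin: "finite E" and span: "span E \<noteq> UNIV"
    and noniso: "\<And>e. e \<in> E \<Longrightarrow> B e e \<noteq> 0"
    and orth: "\<And>e f. e \<in> E \<Longrightarrow> f \<in> E \<Longrightarrow> e \<noteq> f \<Longrightarrow> B e f = 0"
  obtains x where "B x x \<noteq> 0" "\<And>e. e \<in> E \<Longrightarrow> B x e = 0"
proof -
  define proj where "proj x = x - (\<Sum>e\<in>E. scV (B x e / B e e) e)" for x
  have B_sum: "B (\<Sum>e\<in>F. scV (c e) e) y = (\<Sum>e\<in>F. c e * B e y)" if "finite F" for F c y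
    using that by induction (simp_all add: B_simps(1,2,5))
  have proj_orth: "B (proj x) f = 0" if f: "f \<in> E" for x f
  proof -
    have "(\<Sum>e\<in>E. B x e / B e e * B e f) = (\<Sum>e\<in>E. if e = f then B x f else 0)"
      using noniso orth f by (intro sum.cong) auto
    also have "\<dots> = B x f" using fin f by simp
    finally show ?thesis by (simp add: proj_def B_simps B_sum[OF fin])
  qed
  obtain x where x: "x \<notin> span E" using span by auto
  have "proj x \<noteq> 0"
  proof
    assume "proj x = 0"
    then have "x = (\<Sum>e\<in>E. scV (B x e / B e e) e)" by (simp add: proj_def)
    also have "\<dots> \<in> span E" by (intro span_sum span_scale span_base)
    finally show False using x by simp
  qed
  then obtain y where y: "B (proj x) y \<noteq> 0"
    using B_nondegenerate unfolding nondegenerate_form_def by blast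
  have "B (\<Sum>e\<in>E. scV (B y e / B e e) e) (proj x) = 0"
    unfolding B_sum[OF fin] using proj_orth[of _ x] B_sym[of "proj x"] by (intro sum.neutral) simp
  then have xy: "B (proj x) (proj y) \<noteq> 0"
    using y by (simp add: proj_def[of y] B_simps B_sym[of "proj x"])
  have "B (proj x + proj y) (proj x + proj y) = B (proj x) (proj x) + B (proj y) (proj y) + 2 * B (proj x) (proj y)"
    by (simp only: B_simps B_sym[of "proj y" "proj x"] mult_2 add_ac)
  then have "B (proj x) (proj x) \<noteq> 0 \<or> B (proj y) (proj y) \<noteq> 0 \<or> B (proj x + proj y) (proj x + proj y) \<noteq> 0"
    using xy two by auto
  then show ?thesis using that[of "proj x"] that[of "proj y"] that[of "proj x + proj y"] proj_orth
    by (metis B_simps(1) add_0)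
qed

lemma exists_nonisotropic:
  assumes two: "(2::'k) \<noteq> 0"
  obtains e where "B e e \<noteq> 0"
  by (rule exists_orthogonal_nonisotropic[OF two, of "{}"]) (use V_nonzero in auto)

lemma exists_orthogonal_triple:
  assumes two: "(2::'k) \<noteq> 0" and dim: "dim UNIV \<ge> 3"
  obtains e1 e2 e3 where "B e1 e1 \<noteq> 0" "B e2 e2 \<noteq> 0" "B e3 e3 \<noteq> 0"
    "B e1 e2 = 0" "B e1 e3 = 0" "B e2 e3 = 0"
proof -
  have small: "span E \<noteq> UNIV" if "finite E" "card E < 3" for E
    using dim_le_card[of UNIV E] that dim by auto
  obtain e1 where e1: "B e1 e1 \<noteq> 0" by (rule exists_nonisotropic[OF two])
  obtain e2 where e2: "B e2 e2 \<noteq> 0" "\<And>e. e \<in> {e1} \<Longrightarrow> B e2 e = 0"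
    by (rule exists_orthogonal_nonisotropic[OF two, of "{e1}"]) (use small[of "{e1}"] e1 in simp_all)
  have "card {e1, e2} < 3" by (auto simp: card_insert_if)
  then have "span {e1, e2} \<noteq> UNIV" by (intro small) simp_all
  then obtain e3 where e3: "B e3 e3 \<noteq> 0" "\<And>e. e \<in> {e1, e2} \<Longrightarrow> B e3 e = 0"
    by (rule exists_orthogonal_nonisotropic[OF two _, of "{e1, e2}", rotated])
      (use e1 e2 B_sym[of e1 e2] in auto)
  show ?thesis by (rule that[of e1 e2 e3]) (use e1 e2 e3 in \<open>auto simp: B_sym\<close>)
qed

end


section \<open>The second prolongation of the conformal algebra\<close>

context quadratic_space
begin

text \<open>
  If \<open>T x y\<close> always lies in the conformal algebra, with factor \<open>c x y\<close>, then the permutation trick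
  that produces the Levi-Civita connection expresses \<open>T\<close> through \<open>c\<close> and \<open>B\<close>. The symmetry of this
  expression in its first two arguments is a linear condition on \<open>c\<close> which says that \<open>c\<close>, tested on
  orthogonal vectors, has opposite normalised diagonal values \<open>r e\<close> and \<open>r f\<close>. Three mutually
  orthogonal vectors leave no choice but zero.
\<close>

lemma conformal_second_prolongation_zero:
  assumes two: "(2::'k) \<noteq> 0" and dim: "dim UNIV \<ge> 3"
    and T_12: "\<And>x y z. T x y z = T y x z" and T_23: "\<And>x y z. T x y z = T x z y"
    and T_add: "\<And>x y z z'. T x y (z + z') = T x y z + T x y z'"
    and conformal: "\<And>x y. \<exists>c. \<forall>v. B (T x y v) v = c * B v v"
  shows "T x y z = 0"
proof -
  obtain c where c: "\<And>x y v. B (T x y v) v = c x y * B v v" using conformal by metis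
  obtain e1 e2 e3 where e: "B e1 e1 \<noteq> 0" "B e2 e2 \<noteq> 0" "B e3 e3 \<noteq> 0"
    "B e1 e2 = 0" "B e1 e3 = 0" "B e2 e3 = 0"
    by (rule exists_orthogonal_triple[OF two dim])
  note e' = e(4-6)[unfolded B_sym[of e1 e2] B_sym[of e1 e3] B_sym[of e2 e3]]
  have polar: "B (T x y v) w + B (T x y w) v = 2 * c x y * B v w" for x y v w
    using c[of x y "v + w"] c[of x y v] c[of x y w]
    by (simp add: T_add B_simps B_sym[of w v] algebra_simps)
  have c_sym: "c x y = c y x" for x y
    using c[of x y e1] c[of y x e1] e(1) T_12[of x y e1] by simp
  \<comment> \<open>The alternating sum of the three polarised identities isolates one value of \<open>T\<close>.\<close>
  have T_c: "B (T x y z) w = c x y * B z w + c x z * B y w - c x w * B y z" for x y z w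
  proof -
    have "2 * B (T x y z) w = (B (T x y z) w + B (T x y w) z) + (B (T x z y) w + B (T x z w) y)
        - (B (T x w y) z + B (T x w z) y)"
      by (simp add: T_23[of x y z] T_23[of x y w] T_23[of x z w])
    also have "\<dots> = 2 * (c x y * B z w + c x z * B y w - c x w * B y z)"
      unfolding polar by (simp add: algebra_simps)
    finally have "2 * B (T x y z) w = 2 * (c x y * B z w + c x z * B y w - c x w * B y z)" .
    then show ?thesis using two mult_left_cancel by blast
  qed
  have R: "c x z * B y w - B y z * c x w = c y z * B x w - B x z * c y w" for x y z w
    using T_c[of x y z w] T_c[of y x z w] T_12[of x y z] c_sym[of x y] by (simp add: algebra_simps)
  define r where "r e = c e e / B e e" for e
  have r: "r e + r f = 0" if "B e e \<noteq> 0" "B f f \<noteq> 0" "B e f = 0" for e f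
    using R[of e e f f] R[of e f e f] that B_sym[of e f] by (simp add: r_def field_simps)
  have "2 * r e1 = (r e1 + r e2) + (r e1 + r e3) - (r e2 + r e3)" by simp
  also have "\<dots> = 0" using r e by simp
  finally have "r e1 = 0" using two by simp
  then have "r e2 = 0" "r e3 = 0" using r[of e1 e2] r[of e1 e3] e by simp_all
  then have c0: "c e1 e1 = 0" "c e2 e2 = 0" "c e3 e3 = 0"
    using \<open>r e1 = 0\<close> e by (simp_all add: r_def)
  \<comment> \<open>Each \<open>e\<close> with \<open>c e e = 0\<close> expresses \<open>c\<close> through its values on \<open>e\<close>; applying this in turn to
    \<open>e3\<close>, \<open>e2\<close> and \<open>e1\<close> kills \<open>c\<close> altogether.\<close>
  have step: "c x y * B e e = B e y * c x e + c e y * B x e" if "c e e = 0" for x y e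
    using R[of x y e e] that by (simp add: diff_eq_eq add.commute)
  have "c e1 e2 = 0"
    using step[OF c0(3), of e1 e2] e e' by (simp add: B_sym)
  then have "c x e1 = 0" for x
    using step[OF c0(2), of x e1] e e' c_sym[of e1 e2] by (simp add: B_sym)
  then have "c x y = 0" for x y
    using step[OF c0(1), of x y] e c_sym[of e1 y] by simp
  then have "B (T x y z) w = B 0 w" for w by (simp add: T_c B_simps)
  then show ?thesis by (rule B_eqI)
qed

end


section \<open>Clifford multiplication\<close>

context clifford_module
begin

abbreviation clifford_mult :: "'v \<Rightarrow> 'w \<Rightarrow> 'w" (infixr "\<cdot>" 75) where
  "v \<cdot> s \<equiv> act (cl_vec scV B v) s"

text \<open>Scalars are central in the Clifford algebra, so Clifford multiplication is linear in the spinor.\<close>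

lemma clifford_mult_scale_right: "v \<cdot> scW c s = scW c (v \<cdot> s)"
proof -
  have "cl_vec scV B v \<otimes>\<^bsub>clifford_algebra scV B\<^esub> cl_scalar scV B c
      = cl_scalar scV B c \<otimes>\<^bsub>clifford_algebra scV B\<^esub> cl_vec scV B v"
    unfolding cl_vec_def cl_scalar_def clifford_coset_mult free_gen_def free_scalar_def
    by (simp add: mult_single plus_free_word_def mult.commute)
  then show ?thesis
    by (metis act_mult act_scalar cl_vec_carrier cl_scalar_carrier)
qed

lemma clifford_mult_linear: "Vector_Spaces.linear scW scW (\<lambda>s. v \<cdot> s)"
  by (simp add: Vector_Spaces.linear_iff W.vector_space_axioms
      act_add_right[OF cl_vec_carrier] clifford_mult_scale_right)

sublocale clifford_mult: Vector_Spaces.linear scW scW "\<lambda>s. v \<cdot> s" for v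
  by (rule clifford_mult_linear)

lemma clifford_mult_anticommute: "v \<cdot> u \<cdot> s + u \<cdot> v \<cdot> s = scW (- 2 * B v u) s"
proof -
  let ?C = "clifford_algebra scV B"
  interpret C: ring ?C by (rule ring_clifford_algebra)
  have "scW (- 2 * B v u) s = act ((cl_vec scV B v \<otimes>\<^bsub>?C\<^esub> cl_vec scV B u)
      \<oplus>\<^bsub>?C\<^esub> (cl_vec scV B u \<otimes>\<^bsub>?C\<^esub> cl_vec scV B v)) s"
    unfolding clifford_relation act_scalar ..
  then show ?thesis by (simp add: act_add_left act_mult cl_vec_carrier)
qed

lemma clifford_mult_orthogonal:
  assumes "B v u = 0"
  shows "v \<cdot> u \<cdot> s = - (u \<cdot> v \<cdot> s)"
  using clifford_mult_anticommute[of v u s] assms by (simp add: eq_neg_iff_add_eq_0)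

lemma clifford_mult_self:
  assumes two: "(2::'k) \<noteq> 0"
  shows "v \<cdot> v \<cdot> s = scW (- B v v) s"
proof -
  have "scW 2 (v \<cdot> v \<cdot> s) = scW 2 (scW (- B v v) s)"
    using clifford_mult_anticommute[of v v s] W.scale_left_distrib[of 1 1] by simp
  then show ?thesis using two W.scale_left_imp_eq by blast
qed

lemma clifford_mult_inj:
  assumes two: "(2::'k) \<noteq> 0" and nonzero: "B v v \<noteq> 0" and eq: "v \<cdot> s = v \<cdot> t"
  shows "s = t"
proof -
  have "scW (- B v v) s = scW (- B v v) t"
    using eq clifford_mult_self[OF two, of v] by metis
  then show ?thesis using nonzero W.scale_left_imp_eq by (metis neg_equal_0_iff_equal)
qed

lemma clifford_mult_faithful:
  assumes two: "(2::'k) \<noteq> 0" and zero: "\<And>s. v \<cdot> s = 0"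
  shows "v = 0"
proof (rule B_eqI)
  fix u
  obtain s :: 'w where "s \<noteq> 0" using W_nonzero by blast
  moreover have "scW (- 2 * B v u) s = 0"
    using clifford_mult_anticommute[of v u s] zero by (simp add: clifford_mult.zero)
  ultimately show "B v u = B 0 u" using two by (simp add: B_simps)
qed

end


section \<open>Degree-zero derivations of an extended translation algebra\<close>

context extended_translation
begin

abbreviation bracket :: "'w \<Rightarrow> 'w \<Rightarrow> 'v" where
  "bracket s t \<equiv> et_bracket scV B act \<beta> s t"

lemmas \<beta>_simps = bilinear_formD[OF \<beta>_bilinear]

lemma \<beta>_eqI: "(\<And>t. \<beta> s t = \<beta> s' t) \<Longrightarrow> s = s'"
  using \<beta>_nondegenerate \<beta>_simps(9)[of s s'] unfolding nondegenerate_form_def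
  by (metis eq_iff_diff_eq_0)

lemma bracket_nondegenerate:
  assumes two: "(2::'k) \<noteq> 0" and zero: "\<And>t. bracket s t = 0"
  shows "s = 0"
proof -
  obtain e where e: "B e e \<noteq> 0" by (rule exists_nonisotropic[OF two])
  have "e \<cdot> s = e \<cdot> 0"
    by (rule \<beta>_eqI) (metis et_bracket zero B_simps(5) \<beta>_simps(5) clifford_mult.zero)
  then show ?thesis by (rule clifford_mult_inj[OF two e])
qed

text \<open>
  The degree-zero derivations of \<open>\<mm>\<close>, split into their actions on \<open>V\<close> and on \<open>W\<close>. The conditions
  for the other brackets are trivial, since these brackets vanish.
\<close>

definition derivation_pair :: "('v \<Rightarrow> 'v) \<Rightarrow> ('w \<Rightarrow> 'w) \<Rightarrow> bool" where
  "derivation_pair a A \<longleftrightarrow> Vector_Spaces.linear scV scV a \<and> Vector_Spaces.linear scW scW A \<and>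
     (\<forall>s t. a (bracket s t) = bracket (A s) t + bracket s (A t))"

lemma derivation_pair_\<beta>:
  assumes "derivation_pair a A"
  shows "\<beta> (v \<cdot> A s) t + \<beta> (v \<cdot> s) (A t) = B (a (bracket s t)) v"
  using assms by (simp add: derivation_pair_def et_bracket B_simps)

text \<open>
  For every \<open>v\<close>, moving \<open>A\<close> across \<open>\<beta>(v s, t)\<close> costs a sign. Comparing the two ways to do so for the
  product of orthogonal \<open>u\<close> and \<open>v\<close> gives \<open>u A v = - v A u\<close>; cancelling \<open>u\<close> turns this into
  commutation with \<open>v u\<close>.
\<close>

lemma derivation_killing_V_commutes:
  assumes two: "(2::'k) \<noteq> 0" and A: "derivation_pair (\<lambda>_. 0) A"
    and u: "B u u \<noteq> 0" and uv: "B u v = 0"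
  shows "A (v \<cdot> u \<cdot> s) = v \<cdot> u \<cdot> A s"
proof -
  interpret A: Vector_Spaces.linear scW scW A using A by (simp add: derivation_pair_def)
  have skew: "\<beta> (v \<cdot> A s) t = - \<beta> (v \<cdot> s) (A t)" for v s t
    using derivation_pair_\<beta>[OF A, of v s t] by (simp add: B_simps eq_neg_iff_add_eq_0)
  have anti: "u \<cdot> A (v \<cdot> s) = - (v \<cdot> A (u \<cdot> s))" for s
    by (rule \<beta>_eqI) (simp add: skew \<beta>_simps clifford_mult_orthogonal[OF uv])
  have "u \<cdot> A (v \<cdot> u \<cdot> s) = - (v \<cdot> A (u \<cdot> u \<cdot> s))" by (rule anti)
  also have "\<dots> = scW (B u u) (v \<cdot> A s)"
    by (simp add: clifford_mult_self[OF two] A.scale A.neg clifford_mult.scale clifford_mult.neg)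
  also have "\<dots> = - (v \<cdot> u \<cdot> u \<cdot> A s)"
    by (simp add: clifford_mult_self[OF two] clifford_mult.scale clifford_mult.neg)
  also have "\<dots> = u \<cdot> v \<cdot> u \<cdot> A s" by (simp add: clifford_mult_orthogonal[OF uv])
  finally show ?thesis by (rule clifford_mult_inj[OF two u])
qed

text \<open>
  In terms of the \<open>B\<close>-adjoint \<open>a'\<close> and the \<open>\<beta>\<close>-adjoint \<open>A'\<close>, the derivation rule becomes an identity
  between operators on \<open>W\<close>.
\<close>

lemma derivation_pair_adjoint:
  assumes two: "(2::'k) \<noteq> 0" and aA: "derivation_pair a A"
  obtains a' A' where "\<And>x v. B (a x) v = B x (a' v)"
    and "Vector_Spaces.linear scW scW A'"
    and "\<And>v s. a' v \<cdot> s = v \<cdot> A s + A' (v \<cdot> s)"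
proof -
  interpret a: Vector_Spaces.linear scV scV a using aA by (simp add: derivation_pair_def)
  interpret A: Vector_Spaces.linear scW scW A using aA by (simp add: derivation_pair_def)
  obtain e where e: "B e e \<noteq> 0" by (rule exists_nonisotropic[OF two])
  have "Vector_Spaces.linear scV (*) (\<lambda>x. B (a x) v)" for v
    using vector_space_axioms
    by (auto simp: Vector_Spaces.linear_iff a.add a.scale B_simps vector_space_def algebra_simps)
  then have "\<exists>y. \<forall>x. B y x = B (a x) v" for v
    using ex1_representing_vector[of "\<lambda>x. B (a x) v"] by blast
  then obtain a' where "\<And>x v. B (a' v) x = B (a x) v" by metis
  then have a': "B (a x) v = B x (a' v)" for x v by (metis B_sym)
  \<comment> \<open>The identity to be proved, taken at \<open>v = e\<close> and \<open>s = e w\<close>, leaves this as the only choice.\<close>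
  define A' where "A' w = scW (- 1 / B e e) (a' e \<cdot> e \<cdot> w - e \<cdot> A (e \<cdot> w))" for w
  have adjoint: "\<beta> (A' w) t = \<beta> w (A t)" for w t
  proof -
    have "\<beta> (e \<cdot> A (e \<cdot> w)) t + \<beta> (scW (- B e e) w) (A t) = \<beta> (a' e \<cdot> e \<cdot> w) t"
      using derivation_pair_\<beta>[OF aA, of e "e \<cdot> w" t]
      by (simp add: clifford_mult_self[OF two] a' et_bracket)
    then show ?thesis using e by (simp add: A'_def \<beta>_simps field_simps)
  qed
  have rel: "a' v \<cdot> s = v \<cdot> A s + A' (v \<cdot> s)" for v s
    by (rule \<beta>_eqI) (simp add: \<beta>_simps adjoint derivation_pair_\<beta>[OF aA] a' et_bracket)
  have "Vector_Spaces.linear scW scW A'"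
    unfolding Vector_Spaces.linear_iff
    by (intro conjI allI W.vector_space_axioms \<beta>_eqI) (simp_all add: \<beta>_simps adjoint)
  then show ?thesis using that a' rel by blast
qed

text \<open>
  With \<open>S = A + A'\<close>, multiplying the operator identity by \<open>v\<close> on either side and adding gives
  \<open>v S v - (v,v) S = - 2 (a v, v)\<close>, hence \<open>v S + S v = 2 c(v) v\<close> for nonisotropic \<open>v\<close>,
  with \<open>c(v) = (a v, v) / (v, v)\<close>. The left side is linear in \<open>v\<close> and Clifford multiplication is
  faithful, so \<open>c(v)\<close> cannot depend on \<open>v\<close>: it behaves like an eigenvalue of a linear map for which
  every nonisotropic vector is an eigenvector. For isotropic \<open>v\<close> the same identity gives
  \<open>(a v, v) v = 0\<close>.
\<close>

lemma derivation_pair_conformal: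
  assumes two: "(2::'k) \<noteq> 0" and three: "(3::'k) \<noteq> 0" and aA: "derivation_pair a A"
  shows "\<exists>c. \<forall>v. B (a v) v = c * B v v"
proof -
  obtain a' A' where a': "\<And>x v. B (a x) v = B x (a' v)"
    and linA': "Vector_Spaces.linear scW scW A'"
    and rel: "\<And>v s. a' v \<cdot> s = v \<cdot> A s + A' (v \<cdot> s)"
    using derivation_pair_adjoint[OF two aA] by blast
  interpret A: Vector_Spaces.linear scW scW A using aA by (simp add: derivation_pair_def)
  interpret A': Vector_Spaces.linear scW scW A' by (rule linA')
  define S where "S s = A s + A' s" for s
  have S_add: "S (s + t) = S s + S t" and S_scale: "S (scW c s) = scW c (S s)" for s t c
    by (simp_all add: S_def A.add A'.add A.scale A'.scale W.scale_right_distrib)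
  have quad: "v \<cdot> S (v \<cdot> s) - scW (B v v) (S s) = scW (- 2 * B (a v) v) s" for v s
  proof -
    have "v \<cdot> a' v \<cdot> s + a' v \<cdot> v \<cdot> s = v \<cdot> S (v \<cdot> s) - scW (B v v) (S s)"
      by (simp add: rel S_def clifford_mult.add clifford_mult_self[OF two] A'.scale A'.neg
          W.scale_right_distrib)
    then show ?thesis by (simp add: clifford_mult_anticommute a')
  qed
  have eigen: "scW (B v v) (v \<cdot> S s + S (v \<cdot> s)) = scW (2 * B (a v) v) (v \<cdot> s)" for v s
  proof -
    have "v \<cdot> scW (- 2 * B (a v) v) s = v \<cdot> (v \<cdot> S (v \<cdot> s) - scW (B v v) (S s))"
      by (simp only: quad)
    then have "- scW (2 * B (a v) v) (v \<cdot> s) = - scW (B v v) (v \<cdot> S s + S (v \<cdot> s))"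
      by (simp add: clifford_mult.diff clifford_mult.scale clifford_mult.neg
          clifford_mult_self[OF two] W.scale_right_distrib)
    then show ?thesis by simp
  qed
  define c where "c v = B (a v) v / B v v" for v
  have eigen': "v \<cdot> S s + S (v \<cdot> s) = scW (2 * c v) (v \<cdot> s)" if "B v v \<noteq> 0" for v s
  proof -
    have "scW (B v v) (v \<cdot> S s + S (v \<cdot> s)) = scW (B v v) (scW (2 * c v) (v \<cdot> s))"
      using that by (simp add: eigen c_def)
    then show ?thesis using that W.scale_left_imp_eq by blast
  qed
  have c_step: "c u = c v" if u: "B u u \<noteq> 0" and v: "B v v \<noteq> 0" for u v
  proof (cases "\<exists>k. v = scV k u")
    case True
    then obtain k where k: "v = scV k u" by blast
    interpret a: Vector_Spaces.linear scV scV a using aA by (simp add: derivation_pair_def)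
    show ?thesis using v by (simp add: c_def k a.scale B_simps)
  next
    case False
    \<comment> \<open>A quadratic polynomial in \<open>t\<close> with nonzero leading coefficient cannot vanish
      at \<open>1\<close>, \<open>- 1\<close> and \<open>2\<close>.\<close>
    have "\<exists>t. t \<noteq> 0 \<and> B (u + scV t v) (u + scV t v) \<noteq> 0"
    proof (rule ccontr)
      assume "\<not> ?thesis"
      then have *: "B u u + 2 * t * B u v + t * t * B v v = 0" if "t \<noteq> 0" for t
        using that by (auto simp: B_simps B_sym[of v u] algebra_simps)
      have 1: "B u u + 2 * B u v + B v v = 0" and 2: "B u u - 2 * B u v + B v v = 0"
        using *[of 1] *[of "- 1"] by simp_all
      have "2 * (B u u + B v v) = 0"
        using arg_cong2[OF 1 2, of "(+)"] by (simp add: algebra_simps)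
      then have "B u u + B v v = 0" using two mult_eq_0_iff by blast
      then have uv: "B u u = - B v v" by (simp add: eq_neg_iff_add_eq_0)
      then have "B u v = 0" using 1 two by simp
      then have "3 * B v v = 0" using *[OF two] uv by (simp add: algebra_simps)
      then show False using three v by simp
    qed
    then obtain t where t: "t \<noteq> 0" and w: "B (u + scV t v) (u + scV t v) \<noteq> 0" by blast
    let ?w = "u + scV t v"
    \<comment> \<open>Comparing the eigenvector equations for \<open>u\<close>, \<open>v\<close> and \<open>u + t v\<close> shows that \<open>y\<close> acts as zero;
      then \<open>y = 0\<close>, and the independence of \<open>u\<close> and \<open>v\<close> makes both coefficients zero.\<close>
    define y where "y = scV (2 * (c u - c ?w)) u + scV (2 * t * (c v - c ?w)) v"
    have "y \<cdot> s = 0" for s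
    proof -
      have "?w \<cdot> S s + S (?w \<cdot> s) = (u \<cdot> S s + S (u \<cdot> s)) + scW t (v \<cdot> S s + S (v \<cdot> s))"
        by (simp add: act_vec_add act_vec_scale S_add S_scale W.scale_right_distrib)
      then have "scW (2 * c ?w) (?w \<cdot> s) = scW (2 * c u) (u \<cdot> s) + scW (t * (2 * c v)) (v \<cdot> s)"
        by (simp add: eigen' u v w)
      moreover have "y \<cdot> s = scW (2 * (c u - c ?w)) (u \<cdot> s) + scW (2 * t * (c v - c ?w)) (v \<cdot> s)"
        by (simp only: y_def act_vec_add act_vec_scale)
      ultimately show ?thesis
        by (simp add: act_vec_add act_vec_scale algebra_simps)
    qed
    then have y0: "y = 0" by (rule clifford_mult_faithful[OF two])
    have "c v = c ?w"
    proof (rule ccontr)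
      assume ne: "c v \<noteq> c ?w"
      let ?k = "2 * t * (c v - c ?w)"
      have "scV ?k v = scV (- (2 * (c u - c ?w))) u"
        using y0 unfolding y_def scale_minus_left by (simp only: add_eq_0_iff)
      then have "scV (1 / ?k) (scV ?k v) = scV (1 / ?k) (scV (- (2 * (c u - c ?w))) u)" by simp
      then have "v = scV (1 / ?k * - (2 * (c u - c ?w))) u"
        using t two ne by (simp del: mult_minus_right)
      then show False using False by blast
    qed
    moreover from this have "c u = c ?w"
      using y0 u two by (auto simp: y_def B_simps)
    ultimately show ?thesis by simp
  qed
  obtain e where e: "B e e \<noteq> 0" by (rule exists_nonisotropic[OF two])
  have "B (a v) v = c e * B v v" for v
  proof (cases "B v v = 0")
    case False
    then show ?thesis using c_step[OF e False] by (simp add: c_def)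
  next
    case True
    have "B (a v) v = 0"
    proof (rule ccontr)
      assume "B (a v) v \<noteq> 0"
      then have "v \<cdot> s = 0" for s using eigen[of v s] True two by simp
      then have "v = 0" by (rule clifford_mult_faithful[OF two])
      then show False using \<open>B (a v) v \<noteq> 0\<close> by (simp add: B_simps)
    qed
    then show ?thesis using True by simp
  qed
  then show ?thesis by blast
qed

text \<open>
  The symmetry of \<open>T\<close> lets the even elements \<open>a\<close> and \<open>b\<close> be pulled out of \<open>T (a s) (b t)\<close> in
  either order, so \<open>a b - b a\<close> annihilates \<open>T s t\<close>. Two planes that share exactly one axis, as
  those spanned by \<open>e1, e2\<close> and \<open>e2, e3\<close>, give anticommuting \<open>a\<close> and \<open>b\<close>.
\<close>

lemma first_prolongation_killing_V_zero:
  assumes two: "(2::'k) \<noteq> 0" and dim: "dim UNIV \<ge> 3"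
    and T: "\<And>s. derivation_pair (\<lambda>_. 0) (T s)" and sym: "\<And>s t. T s t = T t s"
  shows "T s t = 0"
proof -
  obtain e1 e2 e3 where e: "B e1 e1 \<noteq> 0" "B e2 e2 \<noteq> 0" "B e3 e3 \<noteq> 0"
    "B e1 e2 = 0" "B e1 e3 = 0" "B e2 e3 = 0"
    by (rule exists_orthogonal_triple[OF two dim])
  note anti = clifford_mult_orthogonal[OF e(4)] clifford_mult_orthogonal[OF e(5)]
    clifford_mult_orthogonal[OF e(6)]
  define a where "a s = e1 \<cdot> e2 \<cdot> s" for s
  define b where "b s = e2 \<cdot> e3 \<cdot> s" for s
  have Ta: "T s (a t) = a (T s t)" and Tb: "T s (b t) = b (T s t)" for s t
    unfolding a_def b_def
    using derivation_killing_V_commutes[OF two T e(2), of e1] derivation_killing_V_commutes[OF two T e(3), of e2] e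
    by (simp_all add: B_sym)
  have "b (a (T s t)) = T (a s) (b t)" by (metis Ta Tb sym)
  also have "\<dots> = a (b (T s t))" by (metis Ta Tb sym)
  finally have ab: "b (a (T s t)) = a (b (T s t))" .
  have "a (b w) = scW (- B e2 e2) (e1 \<cdot> e3 \<cdot> w)" for w
    by (simp add: a_def b_def clifford_mult_self[OF two] clifford_mult.scale clifford_mult.neg)
  moreover have "b (a w) = scW (B e2 e2) (e1 \<cdot> e3 \<cdot> w)" for w
  proof -
    have "b (a w) = - (e2 \<cdot> e3 \<cdot> e2 \<cdot> e1 \<cdot> w)"
      by (simp add: a_def b_def anti(1) clifford_mult.neg)
    also have "\<dots> = e2 \<cdot> e2 \<cdot> e3 \<cdot> e1 \<cdot> w"
      by (simp add: anti(3)[of "e1 \<cdot> w"] clifford_mult.neg)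
    also have "\<dots> = - (e2 \<cdot> e2 \<cdot> e1 \<cdot> e3 \<cdot> w)"
      by (simp add: anti(2) clifford_mult.neg)
    finally have "b (a w) = - (e2 \<cdot> e2 \<cdot> e1 \<cdot> e3 \<cdot> w)" .
    then show ?thesis by (simp add: clifford_mult_self[OF two])
  qed
  ultimately have "scW (B e2 e2 - - B e2 e2) (e1 \<cdot> e3 \<cdot> T s t) = 0"
    using ab by (simp only: W.scale_left_diff_distrib) simp
  then have "scW (2 * B e2 e2) (e1 \<cdot> e3 \<cdot> T s t) = 0" by (simp only: diff_minus_eq_add mult_2)
  then have "e1 \<cdot> e3 \<cdot> T s t = e1 \<cdot> e3 \<cdot> 0" using e two by simp
  then show ?thesis using clifford_mult_inj[OF two] e by metis
qed

end


section \<open>Transitive prolongations\<close>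

locale prolongation_of_extended_translation =
  extended_translation scV B scW act \<sigma> \<epsilon> \<beta> + g: graded_lie_algebra sc G br
  for scV :: "'k::field \<Rightarrow> 'v::ab_group_add \<Rightarrow> 'v"
    and B :: "'v \<Rightarrow> 'v \<Rightarrow> 'k"
    and scW :: "'k \<Rightarrow> 'w::ab_group_add \<Rightarrow> 'w"
    and act :: "('v, 'k) free_algebra set \<Rightarrow> 'w \<Rightarrow> 'w"
    and \<sigma> :: "('v \<Rightarrow> 'v) \<Rightarrow> 'w \<Rightarrow> 'w"
    and \<epsilon> :: 'k
    and \<beta> :: "'w \<Rightarrow> 'w \<Rightarrow> 'k"
    and sc :: "'k \<Rightarrow> 'g::ab_group_add \<Rightarrow> 'g"
    and G :: "int \<Rightarrow> 'g set"
    and br :: "'g \<Rightarrow> 'g \<Rightarrow> 'g" +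
  fixes \<iota> :: "'v \<times> 'w \<Rightarrow> 'g"
  assumes two: "(2::'k) \<noteq> 0" and three: "(3::'k) \<noteq> 0" and dim_V: "dim UNIV \<ge> 3"
    and embedding: "graded_lie_embedding (m_scale scV scW) m_component (m_bracket scV B act \<beta>) sc G br \<iota>"
    and negative_part: "p < 0 \<Longrightarrow> \<iota> ` m_component p = G p"
    and components_fin_dim: "fin_dim sc (G p)"
    and transitive: "\<lbrakk>p \<ge> 0; X \<in> G p; \<And>Y. Y \<in> G (- 1) \<Longrightarrow> br X Y = 0\<rbrakk> \<Longrightarrow> X = 0"
begin

definition emb_V :: "'v \<Rightarrow> 'g" where "emb_V v = \<iota> (v, 0)"
definition emb_W :: "'w \<Rightarrow> 'g" where "emb_W s = \<iota> (0, s)"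

lemma total_space_m: "total_space (m_scale scV scW) m_component = UNIV"
proof -
  interpret m: vector_space "m_scale scV scW"
    by (rule vector_space_m_scale[OF vector_space_axioms W.vector_space_axioms])
  have "(v, s) \<in> m.span (\<Union>p. m_component p)" for v :: 'v and s :: 'w
  proof -
    have "(v, 0) \<in> m.span (\<Union>p. m_component p)" "(0, s) \<in> m.span (\<Union>p. m_component p)"
      by (intro m.span_base UN_I[of "- 2"] UN_I[of "- 1"]; simp add: m_component_def)+
    from m.span_add[OF this] show ?thesis by simp
  qed
  then show ?thesis unfolding total_space_def by auto
qed

lemmas \<iota>_hom = graded_lie_embeddingD(2,3,5,6)[OF embedding, unfolded total_space_m, simplified]

lemma emb_V_range: "range emb_V = G (- 2)"
  unfolding emb_V_def negative_part[of "- 2", simplified, symmetric] by (auto simp: m_component_def)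

lemma emb_W_range: "range emb_W = G (- 1)"
  unfolding emb_W_def negative_part[of "- 1", simplified, symmetric] by (auto simp: m_component_def)

lemma emb_V_mem [simp]: "emb_V v \<in> G (- 2)" and emb_W_mem [simp]: "emb_W s \<in> G (- 1)"
  using emb_V_range emb_W_range by auto

lemma emb_W_cases: assumes "X \<in> G (- 1)" obtains s where "X = emb_W s"
  using assms emb_W_range by blast

lemma emb_V_inj [simp]: "emb_V v = emb_V u \<longleftrightarrow> v = u" and emb_W_inj [simp]: "emb_W s = emb_W t \<longleftrightarrow> s = t"
  using \<iota>_hom(4) by (auto simp: emb_V_def emb_W_def inj_eq)

lemma emb_add: "emb_V (v + u) = emb_V v + emb_V u" "emb_W (s + t) = emb_W s + emb_W t"
  by (simp_all add: emb_V_def emb_W_def \<iota>_hom(1)[symmetric])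

lemma emb_scale: "emb_V (scV c v) = sc c (emb_V v)" "emb_W (scW c s) = sc c (emb_W s)"
  by (simp_all add: emb_V_def emb_W_def \<iota>_hom(2)[symmetric] m_scale_def)

lemma emb_zero [simp]: "emb_V 0 = 0" "emb_W 0 = 0"
  using emb_scale[of 0 0] by simp_all

lemma br_mem: "\<lbrakk>X \<in> G p; Y \<in> G q; p + q = r\<rbrakk> \<Longrightarrow> br X Y \<in> G r"
  using g.br_graded by blast

lemma br_V_mem: "X \<in> G p \<Longrightarrow> br X (emb_V v) \<in> G (p - 2)"
  and br_W_mem: "X \<in> G p \<Longrightarrow> br X (emb_W s) \<in> G (p - 1)"
  by (rule br_mem[OF _ emb_V_mem], simp_all) (rule br_mem[OF _ emb_W_mem], simp_all)

lemma br_skew: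
  assumes "X \<in> G p" "Y \<in> G q"
  shows "br X Y = - br Y X"
proof -
  note t = assms[THEN g.component_in_total]
  have "br (X + Y) (X + Y) = 0"
    by (rule g.br_alternating[OF g.subspace_add[OF g.subspace_total t]])
  moreover have "br (X + Y) (X + Y) = br X Y + br Y X"
    using t g.subspace_add[OF g.subspace_total t]
    by (simp add: g.br_add_left g.br_add_right g.br_alternating[OF t(1)] g.br_alternating[OF t(2)])
  ultimately show ?thesis by (simp add: eq_neg_iff_add_eq_0)
qed

lemma br_derivation:
  assumes X: "X \<in> G p" and Y: "Y \<in> G q" and Z: "Z \<in> G r"
  shows "br (br X Y) Z = br (br X Z) Y + br X (br Y Z)"
proof -
  have "br X (br Y Z) + br Y (br Z X) + br Z (br X Y) = 0"
    using assms[THEN g.component_in_total] by (rule g.br_jacobi)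
  moreover have "br Y (br Z X) = br (br X Z) Y"
  proof -
    have "br Y (br Z X) = - br (br Z X) Y" by (rule br_skew[OF Y g.br_graded[OF Z X]])
    also have "br (br Z X) Y = br (- br X Z) Y" by (simp add: br_skew[OF Z X])
    also have "\<dots> = - br (br X Z) Y"
      using g.br_scale_left[of "br X Z" Y "- 1"] g.component_in_total[OF g.br_graded[OF X Z]]
        g.component_in_total[OF Y] by simp
    finally show ?thesis by simp
  qed
  moreover have "br Z (br X Y) = - br (br X Y) Z" by (rule br_skew[OF Z g.br_graded[OF X Y]])
  ultimately show ?thesis by (simp add: algebra_simps)
qed

lemma br_zero_right: "X \<in> G p \<Longrightarrow> br X 0 = 0" and br_zero_left: "X \<in> G p \<Longrightarrow> br 0 X = 0"
  using g.br_scale_right[of X X 0] g.br_scale_left[of X X 0] g.component_in_total by force+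

lemma bracket_zero [simp]: "bracket 0 t = 0" "bracket s 0 = 0"
  by (rule B_eqI; simp add: et_bracket B_simps \<beta>_simps clifford_mult.zero)+

lemma br_emb:
  "br (emb_W s) (emb_W t) = emb_V (bracket s t)"
  "br (emb_V v) (emb_V u) = 0" "br (emb_V v) (emb_W s) = 0" "br (emb_W s) (emb_V v) = 0"
  unfolding emb_V_def emb_W_def \<iota>_hom(3)[symmetric]
  using emb_zero(1) by (simp_all add: m_bracket_def emb_V_def)

text \<open>Brackets with \<open>V\<close> may be reordered freely, since \<open>V\<close> commutes with all of \<open>\<mm>\<close>.\<close>

lemma br_VV_commute:
  "X \<in> G p \<Longrightarrow> br (br X (emb_V v)) (emb_V u) = br (br X (emb_V u)) (emb_V v)"
  and br_VW_commute:
  "X \<in> G p \<Longrightarrow> br (br X (emb_V v)) (emb_W s) = br (br X (emb_W s)) (emb_V v)"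
  using br_derivation[OF _ emb_V_mem emb_V_mem, of X p v u]
    br_derivation[OF _ emb_V_mem emb_W_mem, of X p v s]
  by (simp_all add: br_emb br_zero_right)

lemma degree_zero_derivation:
  assumes X: "X \<in> G 0"
  obtains a A where "derivation_pair a A"
    and "\<And>v. br X (emb_V v) = emb_V (a v)" and "\<And>s. br X (emb_W s) = emb_W (A s)"
proof -
  have "\<exists>u. br X (emb_V v) = emb_V u" for v
    using br_V_mem[OF X, of v] emb_V_range by auto
  then obtain a where a: "\<And>v. br X (emb_V v) = emb_V (a v)" by metis
  have "\<exists>t. br X (emb_W s) = emb_W t" for s
    using br_W_mem[OF X, of s] emb_W_range by auto
  then obtain A where A: "\<And>s. br X (emb_W s) = emb_W (A s)" by metis
  note total = g.component_in_total[OF X] g.component_in_total[OF emb_V_mem]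
    g.component_in_total[OF emb_W_mem]
  have "a (v + u) = a v + a u" "a (scV c v) = scV c (a v)" for v u c
    using g.br_add_right[OF total(1,2,2), of v u] g.br_scale_right[OF total(1,2), of c v]
    by (simp_all add: emb_add[symmetric] emb_scale[symmetric] a)
  moreover have "A (s + t) = A s + A t" "A (scW c s) = scW c (A s)" for s t c
    using g.br_add_right[OF total(1,3,3), of s t] g.br_scale_right[OF total(1,3), of c s]
    by (simp_all add: emb_add[symmetric] emb_scale[symmetric] A)
  moreover have "a (bracket s t) = bracket (A s) t + bracket s (A t)" for s t
  proof -
    have "br X (br (emb_W s) (emb_W t)) = br (br X (emb_W s)) (emb_W t) - br (br X (emb_W t)) (emb_W s)"
      using br_derivation[OF X emb_W_mem emb_W_mem, of s t] by simp
    also have "br (br X (emb_W t)) (emb_W s) = - br (emb_W s) (br X (emb_W t))"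
      unfolding A by (rule br_skew[OF emb_W_mem emb_W_mem])
    finally show ?thesis by (simp add: a A br_emb emb_add[symmetric])
  qed
  ultimately have "derivation_pair a A"
    by (simp add: derivation_pair_def Vector_Spaces.linear_iff vector_space_axioms W.vector_space_axioms)
  then show ?thesis using that a A by blast
qed

lemma transitive_W: "\<lbrakk>p \<ge> 0; X \<in> G p; \<And>s. br X (emb_W s) = 0\<rbrakk> \<Longrightarrow> X = 0"
  using transitive emb_W_cases by metis

text \<open>
  If \<open>X\<close> kills \<open>V\<close>, so does every \<open>[X,s]\<close>, and \<open>[[X,s],t]\<close> is symmetric in \<open>s\<close> and \<open>t\<close> because
  \<open>[s,t]\<close> lies in \<open>V\<close>. So \<open>X\<close> defines an element of the first prolongation of the derivations
  that kill \<open>V\<close>.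
\<close>

lemma degree_one_transitive_V:
  assumes X: "X \<in> G 1" and zero: "\<And>v. br X (emb_V v) = 0"
  shows "X = 0"
proof (rule transitive_W[OF _ X])
  have mem: "br X (emb_W s) \<in> G 0" for s using br_W_mem[OF X] by simp
  have killV: "br (br X (emb_W s)) (emb_V v) = 0" for s v
    by (simp add: br_VW_commute[OF X, symmetric] zero br_zero_left[OF emb_W_mem])
  have "\<exists>A. derivation_pair (\<lambda>_. 0) A \<and> (\<forall>t. br (br X (emb_W s)) (emb_W t) = emb_W (A t))" for s
  proof -
    obtain a A where aA: "derivation_pair a A" "\<And>v. br (br X (emb_W s)) (emb_V v) = emb_V (a v)"
      "\<And>t. br (br X (emb_W s)) (emb_W t) = emb_W (A t)"
      using degree_zero_derivation[OF mem] by metis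
    have "emb_V (a v) = emb_V 0" for v using aA(2) killV by simp
    then have "a = (\<lambda>_. 0)" by (intro ext) (simp only: emb_V_inj)
    then show ?thesis using aA by blast
  qed
  then obtain A where A: "\<And>s. derivation_pair (\<lambda>_. 0) (A s)"
    "\<And>s t. br (br X (emb_W s)) (emb_W t) = emb_W (A s t)" by metis
  have "A s t = A t s" for s t
    using br_derivation[OF X emb_W_mem emb_W_mem, of s t] by (simp add: A br_emb br_zero_right[OF X] zero)
  then have "A s t = 0" for s t
    by (rule first_prolongation_killing_V_zero[OF two dim_V A(1)])
  then show "br X (emb_W s) = 0" for s
    using transitive_W[OF _ mem] A(2) by simp
qed simp

text \<open>If \<open>X\<close> kills \<open>V\<close>, so does \<open>[X,s]\<close>, which has degree one less; transitivity closes the induction.\<close>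

lemma positive_degree_transitive_V:
  assumes "p > 0" and "X \<in> G p" and "\<And>v. br X (emb_V v) = 0"
  shows "X = 0"
proof -
  have "\<lbrakk>X \<in> G (int n + 1); \<And>v. br X (emb_V v) = 0\<rbrakk> \<Longrightarrow> X = 0" for n X
  proof (induction n arbitrary: X)
    case 0
    show ?case by (rule degree_one_transitive_V) (use 0 in simp_all)
  next
    case (Suc n)
    have X: "X \<in> G (int n + 2)" using Suc.prems(1) by (simp add: add.commute)
    have "br X (emb_W s) = 0" for s
    proof (rule Suc.IH)
      show "br X (emb_W s) \<in> G (int n + 1)" by (rule br_mem[OF X emb_W_mem]) simp
      show "br (br X (emb_W s)) (emb_V v) = 0" for v
        by (simp add: br_VW_commute[OF X, symmetric] Suc.prems(2) br_zero_left[OF emb_W_mem])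
    qed
    then show ?case by (intro transitive_W[OF _ X]) simp_all
  qed
  from this[of X "nat (p - 1)"] show ?thesis using assms by (simp del: of_nat_Suc)
qed

text \<open>
  Two brackets with \<open>V\<close> lead from degree four to \<open>\<gg>\<^sub>0\<close>, which acts on \<open>V\<close> conformally; the third is
  that action. The resulting symmetric trilinear map is in the second prolongation of the conformal
  algebra.
\<close>

lemma degree_four_action_V_zero:
  assumes Z: "Z \<in> G 4"
  shows "br (br (br Z (emb_V x)) (emb_V y)) (emb_V z) = 0"
proof -
  have mem: "br (br Z (emb_V x)) (emb_V y) \<in> G 0" for x y
    using br_V_mem[OF br_V_mem[OF Z], of x y] by simp
  have "\<exists>a A. derivation_pair a A \<and> (\<forall>z. br (br (br Z (emb_V x)) (emb_V y)) (emb_V z) = emb_V (a z))" for x y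
    using degree_zero_derivation[OF mem[of x y]] by metis
  then obtain T A where T: "\<And>x y. derivation_pair (T x y) (A x y)"
    "\<And>x y z. br (br (br Z (emb_V x)) (emb_V y)) (emb_V z) = emb_V (T x y z)" by metis
  have "emb_V (T x y z) = emb_V (T y x z)" for x y z
    by (simp add: T(2)[symmetric] br_VV_commute[OF Z, of x y])
  moreover have "emb_V (T x y z) = emb_V (T x z y)" for x y z
    by (simp add: T(2)[symmetric] br_VV_commute[OF br_V_mem[OF Z], of x y z])
  moreover have "T x y (z + z') = T x y z + T x y z'" for x y z z'
    using T(1)[of x y] by (simp add: derivation_pair_def Vector_Spaces.linear_iff)
  ultimately have "T x y z = 0"
    using derivation_pair_conformal[OF two three T(1)]
    by (intro conformal_second_prolongation_zero[OF two dim_V, of T]) simp_all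
  then show ?thesis by (simp add: T(2))
qed

text \<open>
  Odd degrees are better behaved than even ones: three brackets with \<open>V\<close> end in \<open>W\<close> itself, where
  the nondegeneracy of the bracket detects an element by its brackets with \<open>W\<close>. Since \<open>V\<close> commutes
  with \<open>W\<close>, these are the values that the degree-four result, applied to \<open>[X,s]\<close>, makes zero.
\<close>

lemma degree_five_zero:
  assumes X: "X \<in> G 5"
  shows "X = 0"
proof -
  note mem = br_V_mem[OF X] br_V_mem[OF br_V_mem[OF X]] br_V_mem[OF br_V_mem[OF br_V_mem[OF X]]]
  have zero3: "br (br (br X (emb_V x)) (emb_V y)) (emb_V z) = 0" for x y z
  proof -
    obtain f where f: "br (br (br X (emb_V x)) (emb_V y)) (emb_V z) = emb_W f"
      using mem(3)[of x y z] emb_W_range by auto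
    have "bracket f s = 0" for s
    proof -
      have "emb_V (bracket f s) = br (br (br (br X (emb_V x)) (emb_V y)) (emb_V z)) (emb_W s)"
        by (simp add: f br_emb)
      also have "\<dots> = br (br (br (br X (emb_W s)) (emb_V x)) (emb_V y)) (emb_V z)"
        by (simp add: br_VW_commute[OF X] br_VW_commute[OF mem(1)] br_VW_commute[OF mem(2)])
      also have "\<dots> = emb_V 0"
        using degree_four_action_V_zero[of "br X (emb_W s)"] br_W_mem[OF X, of s] by simp
      finally show ?thesis by (simp only: emb_V_inj)
    qed
    then have "f = 0" by (rule bracket_nondegenerate[OF two])
    then show ?thesis by (simp add: f)
  qed
  have "br (br X (emb_V x)) (emb_V y) = 0" for x y
    using positive_degree_transitive_V[OF _ mem(2) zero3] by simp
  then have "br X (emb_V x) = 0" for x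
    using positive_degree_transitive_V[OF _ mem(1)] by simp
  then show ?thesis using positive_degree_transitive_V[OF _ X] by simp
qed

lemma high_degree_zero:
  assumes "p \<ge> 5"
  shows "G p = {0}"
proof -
  have "X \<in> G (int n + 5) \<Longrightarrow> X = 0" for n X
  proof (induction n arbitrary: X)
    case 0
    then show ?case using degree_five_zero by simp
  next
    case (Suc n)
    have "br X (emb_W s) = 0" for s
      by (rule Suc.IH, rule br_mem[OF Suc.prems emb_W_mem]) simp
    then show ?case using transitive_W[OF _ Suc.prems] by simp
  qed
  from this[of _ "nat (p - 5)"] show ?thesis
    using assms g.subspace_0[OF g.component_subspace] by auto
qed

lemma total_space_fin_dim: "fin_dim sc (total_space sc G)"
proof -
  obtain A where A: "\<And>p. finite (A p)" "\<And>p. G p \<subseteq> g.span (A p)"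
    using components_fin_dim unfolding fin_dim_def by metis
  have "G p \<subseteq> g.span (\<Union>q\<in>{- 2..4}. A q)" for p
  proof (cases "p \<in> {- 2..4}")
    case True
    then show ?thesis using A(2)[of p] g.span_mono[of "A p" "\<Union>q\<in>{- 2..4}. A q"] by blast
  next
    case False
    have "G p = {0}"
    proof (cases "p \<ge> 5")
      case False
      then have "p < - 2" using \<open>p \<notin> {- 2..4}\<close> by simp
      then show ?thesis using negative_part[of p] emb_zero(1) by (simp add: m_component_def emb_V_def zero_prod_def)
    qed (rule high_degree_zero)
    then show ?thesis by (simp add: g.span_zero)
  qed
  then have "total_space sc G \<subseteq> g.span (\<Union>q\<in>{- 2..4}. A q)"
    unfolding total_space_def by (intro g.span_minimal g.subspace_span) blast
  then show ?thesis unfolding fin_dim_def using A(1) by (intro exI[of _ "\<Union>q\<in>{- 2..4}. A q"]) simp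
qed

end


section \<open>The ground fields and finite type\<close>

lemma of_nat_nonzero_of_ring_iso:
  fixes f :: "'k::field \<Rightarrow> 'a::field_char_0"
  assumes f: "bij f" "\<forall>x y. f (x + y) = f x + f y \<and> f (x * y) = f x * f y" and n: "n > 0"
  shows "(of_nat n :: 'k) \<noteq> 0"
proof
  assume 0: "of_nat n = (0 :: 'k)"
  have f0: "f 0 = 0" using f(2)[rule_format, of 0 0] by simp
  have "f (of_nat m) = of_nat m * f 1" for m
    by (induction m) (simp_all add: f0 f(2) algebra_simps)
  then have "of_nat n * f 1 = 0" using f0 0 by metis
  then have "f 1 = f 0" using n f0 by simp
  then show False using f(1) by (metis bij_def inj_eq one_neq_zero)
qed

lemma real_or_complex_of_nat_nonzero: "n > 0 \<Longrightarrow> (of_nat n :: 'k::real_or_complex) \<noteq> 0"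
  using real_or_complex[where 'a = 'k] of_nat_nonzero_of_ring_iso by metis

theorem theorem2p4:
  fixes scV :: "'k::real_or_complex \<Rightarrow> 'v::ab_group_add \<Rightarrow> 'v"
    and B :: "'v \<Rightarrow> 'v \<Rightarrow> 'k"
    and scW :: "'k \<Rightarrow> 'w::ab_group_add \<Rightarrow> 'w"
    and act :: "('v, 'k) free_algebra set \<Rightarrow> 'w \<Rightarrow> 'w"
    and \<sigma> :: "('v \<Rightarrow> 'v) \<Rightarrow> 'w \<Rightarrow> 'w"
    and \<epsilon> :: 'k
    and \<beta> :: "'w \<Rightarrow> 'w \<Rightarrow> 'k"
    and sc :: "'k \<Rightarrow> 'g::ab_group_add \<Rightarrow> 'g"
    and G :: "int \<Rightarrow> 'g set"
    and br :: "'g \<Rightarrow> 'g \<Rightarrow> 'g"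
  assumes "extended_translation scV B scW act \<sigma> \<epsilon> \<beta>"
    and "vector_space.dim scV UNIV \<ge> 3"
    and "maximal_transitive_prolongation scV B scW act \<beta> sc G br"
  shows "fin_dim sc (total_space sc G) \<and>
         (\<forall>p>0. \<forall>X\<in>G p. (\<forall>Y\<in>G (- 2). br X Y = 0) \<longrightarrow> X = 0)"
proof -
  interpret et: extended_translation scV B scW act \<sigma> \<epsilon> \<beta> by (rule assms(1))
  have tp: "transitive_prolongation scV B scW act \<beta> sc G br"
    using assms(3) by (simp add: maximal_transitive_prolongation_def)
  interpret g: graded_lie_algebra sc G br by (rule transitive_prolongationD(1)[OF tp])
  obtain \<iota> where \<iota>: "graded_lie_embedding (m_scale scV scW) m_component (m_bracket scV B act \<beta>) sc G br \<iota>"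
    "\<forall>p<0. \<iota> ` m_component p = G p"
    using transitive_prolongationD(3)[OF tp] by blast
  have "(of_nat 2 :: 'k) \<noteq> 0" "(of_nat 3 :: 'k) \<noteq> 0"
    by (rule real_or_complex_of_nat_nonzero, simp)+
  then interpret prolongation_of_extended_translation scV B scW act \<sigma> \<epsilon> \<beta> sc G br \<iota>
    using assms(2) \<iota> transitive_prolongationD(2,4)[OF tp] by unfold_locales auto
  show ?thesis
    using total_space_fin_dim positive_degree_transitive_V emb_V_mem by blast
qed

end
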